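(* Let $G=(V,A)$ be a directed graph in which each arc $a\in A$ carries two resource values $r_a^1,r_a^2$, and let a set of demands be given, each demand $k$ having a source $s_k$, a destination $d_k$ and maximum end-to-end resource consumptions $r_k^1,r_k^2$. Consider the following algorithm. As a pre-processing step, compute $\lambda_k^{\min}$ and $\lambda_k^{\max}$ for each demand $k$, and discard each demand with $\lambda_k^{\min}>\lambda_k^{\max}$ (such a demand cannot be routed with vMTR); let $K$ be the set of remaining demands. Order the demands $k\in K$ in increasing order of $\lambda_k^{\max}$. Start with $\bar K=\emptyset$ and $\Lambda=\emptyset$, and while $K\setminus\bar K\ne\emptyset$: let $\lambda^*$ be the smallest $\lambda_k^{\max}$ such that $k\in K\setminus\bar K$; add to $\bar K$ all demands covered by $\lambda^*$ that are not in $\bar K$; add $\lambda^*$ to $\Lambda$. Finally return $\Lambda$. This algorithm is polynomial and exact for the vMTR weight design problem with two basic topologies, which consists in maximizing the number of accepted demands (first objective) while minimizing the number of virtual topologies (second objective): it runs in polynomial time, and it returns a set $\Lambda$ of multipliers of minimum cardinality such that every demand $k\in K$ is covered by some element of $\Lambda$.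
   Context: Setting: virtual multi-topology routing (vMTR) over two basic topologies, each associated with one resource (QoS metric). A virtual topology is defined by a single multiplier $\lambda$ and has arc weights $r_a^1+\lambda r_a^2$, $a\in A$; a demand is accepted on it if it is covered by $\lambda$ in the sense below. Covering: a multiplier $\lambda$ covers demand $k$ if $\lambda$ is feasible for $k$, i.e. the shortest $s_k$–$d_k$ path $p$ with respect to the arc costs $r_a^1+\lambda r_a^2$ satisfies $\sum_{a\in p} r_a^1\le r_k^1$ and $\sum_{a\in p} r_a^2\le r_k^2$. Multiplier bounds: $\lambda_k^{\min}=\lambda_k^{2*}$ and $\lambda_k^{\max}=1/\lambda_k^{1*}$, where $\lambda_k^{2*}$ (resp. $\lambda_k^{1*}$) is the optimal Lagrangian multiplier provided by the LARAC algorithm when resource 1 is minimized and resource 2 is constrained by $r_k^2$ (resp. when resource 2 is minimized and resource 1 is constrained by $r_k^1$). LARAC is a polynomial-time Lagrangian-relaxation algorithm for the constrained shortest path problem. Writing $P_k$ for the set of $s_k$–$d_k$ paths and $r^i(p)=\sum_{a\in p} r_a^i$, optimal means that $\lambda_k^{2*}$ maximizes $\min_{p\in P_k}(r^1(p)+\lambda r^2(p))-\lambda r_k^2$ over $\lambda\ge0$, and $\lambda_k^{1*}$ maximizes $\min_{p\in P_k}(r^2(p)+\lambda r^1(p))-\lambda r_k^1$ over $\lambda\ge0$. It is known in this setting (claimed in the same work) that every $\lambda$ with $\lambda_k^{\min}\le\lambda\le\lambda_k^{\max}$ is feasible for $k$, and that $\lambda_k^{\min}$ is minimum and $\lambda_k^{\max}$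 is maximum for each demand. Standing assumptions on demands: for each demand at least one $s_k$–$d_k$ path satisfies both resource bounds, and no demand can be accepted on a basic topology, i.e. by routing it on a shortest path for resource 1 alone or for resource 2 alone.
   Formalization: Resource values are taken nonnegative, and a demand with λ_k^min = λ_k^max is assumed covered by that value: this can fail (path resources (0,10), (10,0), (5.1,5.1), bounds 5.2), and then the demand stays in K, no multiplier covers it and the algorithm never ends. *)

theory Defs
  imports
    "HOL-Computational_Algebra.Polynomial"
    "HOL-Library.While_Combinator"
    "HOL-Library.Log_Nat"
    "HOL-Library.Monad_Syntax"
    "Graph_Theory.Arc_Walk"
begin

section \<open>The vMTR weight design problem with two basic topologies\<close>

record ('v, 'a, 'k) vmtr =
  graph :: "('v, 'a) pre_digraph"
  res1 :: "'a \<Rightarrow> real"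
  res2 :: "'a \<Rightarrow> real"
  demands :: "'k set"
  source :: "'k \<Rightarrow> 'v"
  dest :: "'k \<Rightarrow> 'v"
  bound1 :: "'k \<Rightarrow> real"
  bound2 :: "'k \<Rightarrow> real"

definition cost :: "('a \<Rightarrow> real) \<Rightarrow> 'a list \<Rightarrow> real" where
  "cost w p = sum_list (map w p)"

definition demand_paths :: "('v, 'a, 'k) vmtr \<Rightarrow> 'k \<Rightarrow> 'a list set" where
  "demand_paths N k = {p. pre_digraph.apath (graph N) (source N k) p (dest N k)}"

definition shortest_path :: "('v, 'a, 'k) vmtr \<Rightarrow> ('a \<Rightarrow> real) \<Rightarrow> 'k \<Rightarrow> 'a list \<Rightarrow> bool" where
  "shortest_path N w k p \<longleftrightarrow>
     p \<in> demand_paths N k \<and> (\<forall>q \<in> demand_paths N k. cost w p \<le> cost w q)"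

definition within_bounds :: "('v, 'a, 'k) vmtr \<Rightarrow> 'k \<Rightarrow> 'a list \<Rightarrow> bool" where
  "within_bounds N k p \<longleftrightarrow> cost (res1 N) p \<le> bound1 N k \<and> cost (res2 N) p \<le> bound2 N k"

text \<open>
  When several shortest paths exist, the demand may be routed on any one of them.  (At the end
  points of the interval of multipliers of a demand, paths inside and outside the bounds usually
  have the same length, so asking all of them to be within the bounds would rule out the end
  points.)
\<close>

definition accepted_on :: "('v, 'a, 'k) vmtr \<Rightarrow> ('a \<Rightarrow> real) \<Rightarrow> 'k \<Rightarrow> bool" where
  "accepted_on N w k \<longleftrightarrow> (\<exists>p. shortest_path N w k p \<and> within_bounds N k p)"

definition covers :: "('v, 'a, 'k) vmtr \<Rightarrow> real \<Rightarrow> 'k \<Rightarrow> bool" where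
  "covers N \<nu> k \<longleftrightarrow> accepted_on N (\<lambda>a. res1 N a + \<nu> * res2 N a) k"

definition vmtr_instance :: "('v, 'a, 'k) vmtr \<Rightarrow> bool" where
  "vmtr_instance N \<longleftrightarrow>
     fin_digraph (graph N) \<and>
     (\<forall>a \<in> arcs (graph N). 0 \<le> res1 N a \<and> 0 \<le> res2 N a) \<and>
     finite (demands N) \<and>
     (\<forall>k \<in> demands N.
        (\<exists>p \<in> demand_paths N k. within_bounds N k p) \<and>
        \<not> accepted_on N (res1 N) k \<and> \<not> accepted_on N (res2 N) k)"

definition accepted :: "('v, 'a, 'k) vmtr \<Rightarrow> real set \<Rightarrow> 'k set" where
  "accepted N M = {k \<in> demands N. \<exists>\<nu> \<in> M. covers N \<nu> k}"

definition optimal_design :: "('v, 'a, 'k) vmtr \<Rightarrow> real set \<Rightarrow> bool" where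
  "optimal_design N L \<longleftrightarrow>
     finite L \<and> L \<subseteq> {0..} \<and>
     (\<forall>M. finite M \<longrightarrow> M \<subseteq> {0..} \<longrightarrow>
        card (accepted N M) < card (accepted N L) \<or>
        card (accepted N M) = card (accepted N L) \<and> card L \<le> card M)"


section \<open>Multiplier bounds and the algorithm\<close>

definition dual_value ::
  "('v, 'a, 'k) vmtr \<Rightarrow> ('a \<Rightarrow> real) \<Rightarrow> ('a \<Rightarrow> real) \<Rightarrow> real \<Rightarrow> 'k \<Rightarrow> real \<Rightarrow> real" where
  "dual_value N obj con b k \<nu> =
     Min ((\<lambda>p. cost obj p + \<nu> * cost con p) ` demand_paths N k) - \<nu> * b"

text \<open>
  The maximizers of the dual function can form an interval; LARAC stops at its left end point.
\<close>

definition opt_multiplier ::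
  "('v, 'a, 'k) vmtr \<Rightarrow> ('a \<Rightarrow> real) \<Rightarrow> ('a \<Rightarrow> real) \<Rightarrow> real \<Rightarrow> 'k \<Rightarrow> real" where
  "opt_multiplier N obj con b k =
     (LEAST \<nu>. 0 \<le> \<nu> \<and> (\<forall>\<mu>\<ge>0. dual_value N obj con b k \<mu> \<le> dual_value N obj con b k \<nu>))"

definition lam_min :: "('v, 'a, 'k) vmtr \<Rightarrow> 'k \<Rightarrow> real" where
  "lam_min N k = opt_multiplier N (res1 N) (res2 N) (bound2 N k) k"

definition lam_max :: "('v, 'a, 'k) vmtr \<Rightarrow> 'k \<Rightarrow> real" where
  "lam_max N k = 1 / opt_multiplier N (res2 N) (res1 N) (bound1 N k) k"

definition remaining :: "('v, 'a, 'k) vmtr \<Rightarrow> 'k set" where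
  "remaining N = {k \<in> demands N. lam_min N k \<le> lam_max N k}"

text \<open>
  All multipliers in \<open>{lam_min N k..lam_max N k}\<close> should cover \<open>k\<close>.  This needs to be required only
  when the interval is a single point: there, one shortest path satisfies the first bound and one
  satisfies the second, but possibly none satisfies both (three paths with consumptions \<open>(0, 10)\<close>,
  \<open>(10, 0)\<close> and \<open>(5.1, 5.1)\<close>, both bounds \<open>5.2\<close>).  On such a demand the loop below would not
  terminate.
\<close>

definition degenerate_feasible :: "('v, 'a, 'k) vmtr \<Rightarrow> bool" where
  "degenerate_feasible N \<longleftrightarrow>
     (\<forall>k \<in> demands N. lam_min N k = lam_max N k \<longrightarrow> covers N (lam_min N k) k)"

definition vmtr_step :: "('v, 'a, 'k) vmtr \<Rightarrow> 'k set \<times> real set \<Rightarrow> 'k set \<times> real set" where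
  "vmtr_step N = (\<lambda>(Kbar, L).
     let l = Min (lam_max N ` (remaining N - Kbar))
     in (Kbar \<union> {k \<in> remaining N. covers N l k}, insert l L))"

definition vmtr_algorithm :: "('v, 'a, 'k) vmtr \<Rightarrow> real set option" where
  "vmtr_algorithm N =
     map_option snd
       (while_option (\<lambda>(Kbar, L). remaining N - Kbar \<noteq> {}) (vmtr_step N) ({}, {}))"


section \<open>Computations with bit cost\<close>

text \<open>
  \<open>Some (x, t)\<close> is a computation that returns \<open>x\<close> after \<open>t\<close> steps, \<open>None\<close> one that diverges.
  Returning a value costs one step, and an operation on two rationals costs the square of the total
  bit length of the operands (schoolbook arithmetic on reduced fractions).
\<close>

type_synonym 'x timed = "('x \<times> nat) option"

definition ret :: "'x \<Rightarrow> 'x timed" where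
  "ret x = Some (x, 1)"

definition tbind :: "'x timed \<Rightarrow> ('x \<Rightarrow> 'y timed) \<Rightarrow> 'y timed" where
  "tbind m f =
     Option.bind m (\<lambda>(x, t). Option.bind (f x) (\<lambda>(y, u). Some (y, t + u)))"

no_adhoc_overloading Monad_Syntax.bind \<rightleftharpoons> Option.bind
adhoc_overloading Monad_Syntax.bind \<rightleftharpoons> tbind

lemma tbind_mono [partial_function_mono]:
  assumes "mono_option B" and "\<And>y. mono_option (C y)"
  shows "mono_option (\<lambda>f. tbind (B f) (\<lambda>y. C y f))"
  unfolding tbind_def case_prod_beta
  by (intro bind_mono assms option.const_mono)

definition rat_bits :: "rat \<Rightarrow> nat" where
  "rat_bits q = (case quotient_of q of (a, b) \<Rightarrow> nat (bitlen \<bar>a\<bar>) + nat (bitlen b))"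

definition rat_op :: "(rat \<Rightarrow> rat \<Rightarrow> 'x) \<Rightarrow> rat \<Rightarrow> rat \<Rightarrow> 'x timed" where
  "rat_op f x y = Some (f x y, (rat_bits x + rat_bits y)\<^sup>2)"

fun lookup :: "'x option list \<Rightarrow> nat \<Rightarrow> 'x option timed" where
  "lookup [] i = ret None"
| "lookup (x # xs) 0 = ret x"
| "lookup (x # xs) (Suc i) = do { y \<leftarrow> lookup xs i; ret y }"

fun update :: "'x list \<Rightarrow> nat \<Rightarrow> 'x \<Rightarrow> 'x list timed" where
  "update [] i y = ret []"
| "update (x # xs) 0 y = ret (y # xs)"
| "update (x # xs) (Suc i) y = do { ys \<leftarrow> update xs i y; ret (x # ys) }"

fun copies :: "nat \<Rightarrow> 'x \<Rightarrow> 'x list timed" where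
  "copies 0 x = ret []"
| "copies (Suc n) x = do { xs \<leftarrow> copies n x; ret (x # xs) }"


section \<open>Shortest paths (Bellman--Ford) and LARAC\<close>

text \<open>
  An arc \<open>(u, v, a, b)\<close> leads from \<open>u\<close> to \<open>v\<close> and consumes \<open>a\<close> of the objective resource and \<open>b\<close> of the
  constrained one.  The label \<open>(x, y)\<close> of a vertex holds the two consumptions of a walk to it;
  walks are compared by \<open>\<alpha> * x + \<beta> * y\<close>.
\<close>

type_synonym arc = "nat \<times> nat \<times> rat \<times> rat"
type_synonym label = "rat \<times> rat"

definition weight :: "rat \<Rightarrow> rat \<Rightarrow> label \<Rightarrow> rat timed" where
  "weight \<alpha> \<beta> l = do {
     p \<leftarrow> rat_op (*) \<alpha> (fst l);
     q \<leftarrow> rat_op (*) \<beta> (snd l);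
     rat_op (+) p q }"

definition improves :: "rat \<Rightarrow> rat \<Rightarrow> label \<Rightarrow> label option \<Rightarrow> bool timed" where
  "improves \<alpha> \<beta> l m = (case m of
       None \<Rightarrow> ret True
     | Some l' \<Rightarrow> do {
         w \<leftarrow> weight \<alpha> \<beta> l;
         w' \<leftarrow> weight \<alpha> \<beta> l';
         rat_op (<) w w' })"

definition relax ::
  "rat \<Rightarrow> rat \<Rightarrow> label option list \<Rightarrow> arc \<Rightarrow> label option list \<Rightarrow> label option list timed" where
  "relax \<alpha> \<beta> old = (\<lambda>(u, v, a, b) new. do {
     lu \<leftarrow> lookup old u;
     case lu of
       None \<Rightarrow> ret new
     | Some l \<Rightarrow> do {
         x \<leftarrow> rat_op (+) (fst l) a;
         y \<leftarrow> rat_op (+) (snd l) b;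
         lv \<leftarrow> lookup new v;
         better \<leftarrow> improves \<alpha> \<beta> (x, y) lv;
         if better then update new v (Some (x, y)) else ret new } })"

fun relax_all ::
  "rat \<Rightarrow> rat \<Rightarrow> label option list \<Rightarrow> arc list \<Rightarrow> label option list \<Rightarrow> label option list timed"
where
  "relax_all \<alpha> \<beta> old [] new = ret new"
| "relax_all \<alpha> \<beta> old (e # es) new = do {
     new' \<leftarrow> relax \<alpha> \<beta> old e new;
     relax_all \<alpha> \<beta> old es new' }"

fun rounds ::
  "rat \<Rightarrow> rat \<Rightarrow> arc list \<Rightarrow> nat \<Rightarrow> label option list \<Rightarrow> label option list timed" where
  "rounds \<alpha> \<beta> es 0 ls = ret ls"
| "rounds \<alpha> \<beta> es (Suc i) ls = do {
     ls' \<leftarrow> relax_all \<alpha> \<beta> ls es ls;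
     rounds \<alpha> \<beta> es i ls' }"

definition bellman_ford ::
  "nat \<Rightarrow> arc list \<Rightarrow> rat \<Rightarrow> rat \<Rightarrow> nat \<Rightarrow> nat \<Rightarrow> label option timed" where
  "bellman_ford n es \<alpha> \<beta> s t = do {
     ls0 \<leftarrow> copies n None;
     ls1 \<leftarrow> update ls0 s (Some (0, 0));
     ls \<leftarrow> rounds \<alpha> \<beta> es n ls1;
     lookup ls t }"

text \<open>
  LARAC: \<open>pc\<close> is a path violating the constraint, \<open>pd\<close> one satisfying it.  The multiplier for which
  both are equally long is optimal unless there is a shorter path, which then replaces one of them.
\<close>

partial_function (option) larac_loop ::
  "nat \<Rightarrow> arc list \<Rightarrow> nat \<Rightarrow> nat \<Rightarrow> rat \<Rightarrow> label \<Rightarrow> label \<Rightarrow> rat option timed" where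
  "larac_loop n es s t b pc pd = do {
     num \<leftarrow> rat_op (-) (fst pd) (fst pc);
     den \<leftarrow> rat_op (-) (snd pc) (snd pd);
     lam \<leftarrow> rat_op (/) num den;
     res \<leftarrow> bellman_ford n es 1 lam s t;
     case res of
       None \<Rightarrow> ret None
     | Some r \<Rightarrow> do {
         wr \<leftarrow> weight 1 lam r;
         wc \<leftarrow> weight 1 lam pc;
         stop \<leftarrow> rat_op (=) wr wc;
         if stop then ret (Some lam)
         else do {
           ok \<leftarrow> rat_op (\<le>) (snd r) b;
           if ok then larac_loop n es s t b pc r else larac_loop n es s t b r pd } } }"

text \<open>The result \<open>None\<close> means that no path satisfies the constraint.\<close>

definition larac :: "nat \<Rightarrow> arc list \<Rightarrow> nat \<Rightarrow> nat \<Rightarrow> rat \<Rightarrow> rat option timed" where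
  "larac n es s t b = do {
     c \<leftarrow> bellman_ford n es 1 0 s t;
     d \<leftarrow> bellman_ford n es 0 1 s t;
     case (c, d) of
       (Some pc, Some pd) \<Rightarrow> do {
         okc \<leftarrow> rat_op (\<le>) (snd pc) b;
         okd \<leftarrow> rat_op (\<le>) (snd pd) b;
         if okc then ret (Some 0)
         else if okd then larac_loop n es s t b pc pd
         else ret None }
     | _ \<Rightarrow> ret None }"


section \<open>The algorithm as a program on encoded instances\<close>

record vmtr_input =
  num_verts :: nat
  arc_list :: "arc list"
  demand_list :: "(nat \<times> nat \<times> rat \<times> rat) list"

definition instance_of :: "vmtr_input \<Rightarrow> (nat, nat, nat) vmtr" where
  "instance_of I = \<lparr>
     graph = \<lparr>
       verts = {..<num_verts I},
       arcs = {..<length (arc_list I)},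
       tail = (\<lambda>i. case arc_list I ! i of (u, v, a, b) \<Rightarrow> u),
       head = (\<lambda>i. case arc_list I ! i of (u, v, a, b) \<Rightarrow> v) \<rparr>,
     res1 = (\<lambda>i. case arc_list I ! i of (u, v, a, b) \<Rightarrow> of_rat a),
     res2 = (\<lambda>i. case arc_list I ! i of (u, v, a, b) \<Rightarrow> of_rat b),
     demands = {..<length (demand_list I)},
     source = (\<lambda>k. case demand_list I ! k of (s, t, b1, b2) \<Rightarrow> s),
     dest = (\<lambda>k. case demand_list I ! k of (s, t, b1, b2) \<Rightarrow> t),
     bound1 = (\<lambda>k. case demand_list I ! k of (s, t, b1, b2) \<Rightarrow> of_rat b1),
     bound2 = (\<lambda>k. case demand_list I ! k of (s, t, b1, b2) \<Rightarrow> of_rat b2) \<rparr>"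

text \<open>The vertex set is listed, so \<open>num_verts\<close> is counted in full; numbers count by bit length.\<close>

definition input_size :: "vmtr_input \<Rightarrow> nat" where
  "input_size I = num_verts I +
     (\<Sum>(u, v, a, b) \<leftarrow> arc_list I. 1 + rat_bits a + rat_bits b) +
     (\<Sum>(s, t, b1, b2) \<leftarrow> demand_list I. 1 + rat_bits b1 + rat_bits b2)"

fun swap_resources :: "arc list \<Rightarrow> arc list timed" where
  "swap_resources [] = ret []"
| "swap_resources ((u, v, a, b) # es) = do {
     es' \<leftarrow> swap_resources es;
     ret ((u, v, b, a) # es') }"

text \<open>From here on a demand is represented by the pair of its two multiplier bounds.\<close>

fun preprocess ::
  "nat \<Rightarrow> arc list \<Rightarrow> arc list \<Rightarrow> (nat \<times> nat \<times> rat \<times> rat) list \<Rightarrow> (rat \<times> rat) list timed" where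
  "preprocess n es es' [] = ret []"
| "preprocess n es es' ((s, t, b1, b2) # ds) = do {
     ks \<leftarrow> preprocess n es es' ds;
     m2 \<leftarrow> larac n es s t b2;
     m1 \<leftarrow> larac n es' s t b1;
     case (m2, m1) of
       (Some l2, Some l1) \<Rightarrow> do {
         lmax \<leftarrow> rat_op (/) 1 l1;
         keep \<leftarrow> rat_op (\<le>) l2 lmax;
         ret (if keep then (l2, lmax) # ks else ks) }
     | _ \<Rightarrow> ret ks }"

fun insert_demand :: "rat \<times> rat \<Rightarrow> (rat \<times> rat) list \<Rightarrow> (rat \<times> rat) list timed" where
  "insert_demand k [] = ret [k]"
| "insert_demand k (j # js) = do {
     le \<leftarrow> rat_op (\<le>) (snd k) (snd j);
     if le then ret (k # j # js)
     else do { ks \<leftarrow> insert_demand k js; ret (j # ks) } }"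

fun sort_demands :: "(rat \<times> rat) list \<Rightarrow> (rat \<times> rat) list timed" where
  "sort_demands [] = ret []"
| "sort_demands (k # ks) = do { js \<leftarrow> sort_demands ks; insert_demand k js }"

text \<open>
  Covering is tested by comparison with the multiplier bounds.  Under \<^const>\<open>degenerate_feasible\<close>
  this agrees with \<^const>\<open>covers\<close>; a direct search for a shortest path within both bounds could have
  to go through exponentially many tied paths.
\<close>

fun drop_covered :: "rat \<Rightarrow> (rat \<times> rat) list \<Rightarrow> (rat \<times> rat) list timed" where
  "drop_covered l [] = ret []"
| "drop_covered l (k # ks) = do {
     js \<leftarrow> drop_covered l ks;
     lo \<leftarrow> rat_op (\<le>) (fst k) l;
     hi \<leftarrow> rat_op (\<le>) l (snd k);
     ret (if lo \<and> hi then js else k # js) }"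

partial_function (option) greedy_loop :: "(rat \<times> rat) list \<Rightarrow> rat list timed" where
  "greedy_loop ks = (case ks of
       [] \<Rightarrow> ret []
     | k # ks' \<Rightarrow> do {
         js \<leftarrow> drop_covered (snd k) ks';
         ls \<leftarrow> greedy_loop js;
         ret (snd k # ls) })"

definition vmtr_program :: "vmtr_input \<Rightarrow> rat list timed" where
  "vmtr_program I = do {
     es' \<leftarrow> swap_resources (arc_list I);
     ks \<leftarrow> preprocess (num_verts I) (arc_list I) es' (demand_list I);
     js \<leftarrow> sort_demands ks;
     greedy_loop js }"

end

theory Submission
  imports Defs
begin

text \<open>
  The multipliers covering a demand form the interval between its two bounds: along increasing
  multipliers, shortest paths consume less and less of resource 2 and more and more of resource 1.
  The algorithm is then the greedy solution of interval stabbing; the demand that determines a new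
  multiplier has its lower bound above all previous ones, so any other cover must spend a further
  multiplier on it.

  LARAC needs only linearly many iterations, for the following reason.  In the
  plane of path consumptions, the two current paths \<open>c\<close>, \<open>d\<close> and their supporting lines bound a
  triangle that contains all candidates.  A path of least length is a point of that triangle furthest
  from the chord, and either of the two triangles that it leaves has at most a quarter of the area.
  Consumptions have a common denominator \<open>D\<close> of polynomial length, so areas are multiples of
  \<open>1 / (2 * D\<^sup>2)\<close>.
\<close>

section \<open>Critical multipliers\<close>

text \<open>Three obstacles shape the proof. At the ends of an interval several paths tie. So the
  thresholds speak of all shortest paths strictly below or above, but only of some shortest path at
  the threshold itself; combining the two resources then works for intervals with interior, and
  \<open>degenerate_feasible\<close> supplies the single points. Next, bit lengths: each stored
  label belongs to a simple path and each multiplier is a quotient of label differences, so sizes do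
  not depend on the number of rounds that produced them. Finally, the abstract loop works on sets of
  demands and real multipliers, the program on lists of rational intervals; the two are compared
  through the set of intervals, which is blind to repetitions and to the order among ties.

  The iteration count of LARAC comes from integrality: scaled by \<open>D\<^sup>2\<close>, the first
  triangle has \<open>cross\<close> at most \<open>4 ^ (3 * S)\<close>, and every further iteration
  needs a triangle of three labels whose scaled value is a positive integer.\<close>

definition minimal_at :: "'p set \<Rightarrow> ('p \<Rightarrow> real) \<Rightarrow> ('p \<Rightarrow> real) \<Rightarrow> real \<Rightarrow> 'p \<Rightarrow> bool" where
  "minimal_at P f g \<nu> p \<longleftrightarrow> p \<in> P \<and> (\<forall>q \<in> P. f p + \<nu> * g p \<le> f q + \<nu> * g q)"

lemma minimal_at_exists:
  assumes "finite P" and "P \<noteq> {}"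
  obtains p where "minimal_at P f g \<nu> p"
proof -
  let ?w = "\<lambda>p. f p + \<nu> * g p"
  have "Min (?w ` P) \<in> ?w ` P"
    using assms by (intro Min_in) auto
  then obtain p where "p \<in> P" "?w p = Min (?w ` P)"
    by force
  then show thesis
    using assms by (intro that[of p]) (simp add: minimal_at_def)
qed

text \<open>Exchange argument: adding the two optimality inequalities cancels \<open>f\<close>. Both
  points are arbitrary minimizers, so ties need no care.\<close>

lemma minimal_at_antimono:
  assumes "minimal_at P f g \<mu> p" and "minimal_at P f g \<nu> q" and "\<mu> < \<nu>"
  shows "g q \<le> g p"
proof -
  have "f p + \<mu> * g p \<le> f q + \<mu> * g q" and "f q + \<nu> * g q \<le> f p + \<nu> * g p"
    using assms by (auto simp: minimal_at_def)
  then have "(\<nu> - \<mu>) * (g q - g p) \<le> 0"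
    by (simp add: algebra_simps)
  then show ?thesis
    using \<open>\<mu> < \<nu>\<close> by (simp add: mult_le_0_iff)
qed

text \<open>Scaling a weight by \<nu> keeps its minimizers. Exchanging the resources thus amounts to
  passing to the reciprocal multiplier, which is how \<open>lam_max\<close> is handled.\<close>

lemma minimal_at_inverse:
  assumes "0 < \<nu>"
  shows "minimal_at P g f (1 / \<nu>) p \<longleftrightarrow> minimal_at P f g \<nu> p"
proof -
  have "(g p + 1 / \<nu> * f p \<le> g q + 1 / \<nu> * f q) \<longleftrightarrow> (f p + \<nu> * g p \<le> f q + \<nu> * g q)" for q
  proof -
    have "(g p + 1 / \<nu> * f p \<le> g q + 1 / \<nu> * f q)
      \<longleftrightarrow> \<nu> * (g p + 1 / \<nu> * f p) \<le> \<nu> * (g q + 1 / \<nu> * f q)"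
      using assms by simp
    also have "\<dots> \<longleftrightarrow> (f p + \<nu> * g p \<le> f q + \<nu> * g q)"
      using assms by (simp add: algebra_simps)
    finally show ?thesis .
  qed
  then show ?thesis
    by (simp add: minimal_at_def)
qed

text \<open>
  For a point \<open>p\<close> within the bound, \<open>\<theta> p\<close> is the least multiplier at which no point outside the
  bound is shorter than \<open>p\<close>; the critical multiplier is the least of these.
\<close>

lemma critical_multiplier:
  fixes f g :: "'p \<Rightarrow> real"
  assumes fin: "finite P" and p0: "p0 \<in> P" "g p0 \<le> b"
    and out0: "\<And>p. minimal_at P f g 0 p \<Longrightarrow> b < g p"
  obtains \<nu> p q where "0 < \<nu>" "minimal_at P f g \<nu> p" "g p \<le> b" "minimal_at P f g \<nu> q" "b < g q"
proof -
  define I where "I = {p \<in> P. g p \<le> b}"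
  define J where "J = {p \<in> P. b < g p}"
  obtain z where z: "minimal_at P f g 0 z"
    using minimal_at_exists[of P f g 0] fin p0 by auto
  then have zJ: "z \<in> J"
    using out0 by (auto simp: J_def minimal_at_def)
  have finI: "finite I" and finJ: "finite J" and neI: "I \<noteq> {}"
    using fin p0 by (auto simp: I_def J_def)
  define \<theta> where "\<theta> = (\<lambda>p. Max ((\<lambda>q. (f p - f q) / (g q - g p)) ` J))"
  have le_iff: "\<theta> p \<le> \<nu> \<longleftrightarrow> (\<forall>q \<in> J. f p + \<nu> * g p \<le> f q + \<nu> * g q)" if "p \<in> I" for p \<nu>
  proof -
    \<comment> \<open>The quotient is the multiplier at which the inside point \<open>p\<close> and
      the outside point \<open>q\<close> tie; from there on \<open>p\<close> wins, because
      \<open>g p < g q\<close>.\<close>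
    have "(f p - f q) / (g q - g p) \<le> \<nu> \<longleftrightarrow> f p + \<nu> * g p \<le> f q + \<nu> * g q" if "q \<in> J" for q
      using that \<open>p \<in> I\<close> by (simp add: I_def J_def field_simps)
    then show ?thesis
      using finJ zJ unfolding \<theta>_def by (subst Max_le_iff) auto
  qed
  define \<nu> where "\<nu> = Min (\<theta> ` I)"
  have "\<nu> \<in> \<theta> ` I"
    using finI neI by (auto simp: \<nu>_def)
  then obtain p1 where p1: "p1 \<in> I" "\<theta> p1 = \<nu>"
    by auto
  have "\<theta> p1 \<in> (\<lambda>q. (f p1 - f q) / (g q - g p1)) ` J"
    unfolding \<theta>_def using finJ zJ by (intro Max_in) auto
  then obtain q1 where q1: "q1 \<in> J" "\<nu> = (f p1 - f q1) / (g q1 - g p1)"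
    using p1 by auto
  have eq: "f p1 + \<nu> * g p1 = f q1 + \<nu> * g q1"
    using q1 p1 by (simp add: I_def J_def field_simps)
  \<comment> \<open>\<open>out0\<close> forbids a minimizer at 0 within the bound, so
    \<open>p1\<close> loses to \<open>z\<close> there; this makes its threshold positive.\<close>
  have "f z < f p1"
  proof (rule ccontr)
    assume "\<not> f z < f p1"
    then have "minimal_at P f g 0 p1"
      using z p1 by (force simp: minimal_at_def I_def)
    then show False
      using out0 p1 by (force simp: I_def)
  qed
  then have "\<not> \<theta> p1 \<le> 0"
    using le_iff[OF p1(1), of 0] zJ by force
  then have "0 < \<nu>"
    using p1 by simp
  have min: "f p1 + \<nu> * g p1 \<le> f q + \<nu> * g q" if "q \<in> P" for q
  proof (cases "q \<in> J")
    case True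
    then show ?thesis
      using le_iff[OF p1(1), of \<nu>] p1 by simp
  next
    case False
    then have qI: "q \<in> I"
      using that by (auto simp: I_def J_def)
    show ?thesis
    proof (rule ccontr)
      \<comment> \<open>A point within the bound that beats \<open>p1\<close> at \<nu> beats all
        outside points strictly, so its own threshold would be below the minimum \<nu>.\<close>
      assume less: "\<not> ?thesis"
      have "f q + \<nu> * g q < f r + \<nu> * g r" if "r \<in> J" for r
        using le_iff[OF p1(1), of \<nu>] p1 that less by fastforce
      then have "(f q - f r) / (g r - g q) < \<nu>" if "r \<in> J" for r
        using that qI by (simp add: I_def J_def field_simps)
      then have "\<theta> q < \<nu>"
        unfolding \<theta>_def using finJ zJ by (subst Max_less_iff) auto
      moreover have "\<nu> \<le> \<theta> q"
        using finI qI by (simp add: \<nu>_def)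
      ultimately show False
        by simp
    qed
  qed
  show thesis
  proof (rule that)
    show "0 < \<nu>"
      by fact
    show "minimal_at P f g \<nu> p1" "g p1 \<le> b" "minimal_at P f g \<nu> q1" "b < g q1"
      using min p1 q1 eq by (auto simp: minimal_at_def I_def J_def)
  qed
qed

text \<open>The dual function is a minimum of affine functions, one per path, of slope
  \<open>cost g r - b\<close>. At \<nu> it is touched by the line of \<open>q\<close>, of positive
  slope, and by that of \<open>p\<close>, of slope at most 0. Values to the left are therefore
  strictly smaller and values to the right not larger, which makes \<nu> the least maximizer even if
  \<open>p\<close> meets the bound exactly.\<close>

lemma opt_multiplier_eqI:
  assumes fin: "finite (demand_paths N k)" and "0 \<le> \<nu>"
    and p: "minimal_at (demand_paths N k) (cost f) (cost g) \<nu> p" "cost g p \<le> b"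
    and q: "minimal_at (demand_paths N k) (cost f) (cost g) \<nu> q" "b < cost g q"
  shows "opt_multiplier N f g b k = \<nu>"
proof -
  let ?d = "dual_value N f g b k"
  have le: "?d \<mu> \<le> cost f r + \<mu> * (cost g r - b)" if "r \<in> demand_paths N k" for r \<mu>
  proof -
    have "Min ((\<lambda>p. cost f p + \<mu> * cost g p) ` demand_paths N k) \<le> cost f r + \<mu> * cost g r"
      using fin that by (intro Min_le) auto
    then show ?thesis
      by (simp add: dual_value_def algebra_simps)
  qed
  have eq: "?d \<nu> = cost f r + \<nu> * (cost g r - b)"
    if "minimal_at (demand_paths N k) (cost f) (cost g) \<nu> r" for r
  proof -
    have "Min ((\<lambda>p. cost f p + \<nu> * cost g p) ` demand_paths N k) = cost f r + \<nu> * cost g r"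
      using fin that by (intro Min_eqI) (auto simp: minimal_at_def)
    then show ?thesis
      by (simp add: dual_value_def algebra_simps)
  qed
  have less: "?d \<mu> < ?d \<nu>" if "\<mu> < \<nu>" for \<mu>
  proof -
    have "?d \<mu> \<le> cost f q + \<mu> * (cost g q - b)"
      using q by (intro le) (auto simp: minimal_at_def)
    also have "\<dots> < cost f q + \<nu> * (cost g q - b)"
      using q that by simp
    finally show ?thesis
      using eq[OF q(1)] by simp
  qed
  have ge: "?d \<mu> \<le> ?d \<nu>" if "\<nu> \<le> \<mu>" for \<mu>
  proof -
    have "?d \<mu> \<le> cost f p + \<mu> * (cost g p - b)"
      using p by (intro le) (auto simp: minimal_at_def)
    also have "\<dots> \<le> cost f p + \<nu> * (cost g p - b)"
      using p that by (simp add: mult_right_mono_neg)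
    finally show ?thesis
      using eq[OF p(1)] by simp
  qed
  show ?thesis
    unfolding opt_multiplier_def
  proof (rule Least_equality)
    show "0 \<le> \<nu> \<and> (\<forall>\<mu>\<ge>0. ?d \<mu> \<le> ?d \<nu>)"
      using \<open>0 \<le> \<nu>\<close> less ge by (meson less_imp_le linorder_not_le)
    show "\<nu> \<le> \<mu>" if "0 \<le> \<mu> \<and> (\<forall>\<mu>'\<ge>0. ?d \<mu>' \<le> ?d \<mu>)" for \<mu>
      using that \<open>0 \<le> \<nu>\<close> less by (meson linorder_not_le)
  qed
qed

section \<open>Thresholds of the multipliers of a demand\<close>

lemma finite_demand_paths:
  assumes "vmtr_instance N"
  shows "finite (demand_paths N k)"
  unfolding demand_paths_def
  using assms by (intro fin_digraph.apaths_finite) (simp add: vmtr_instance_def)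

lemma shortest_path_iff_minimal_at:
  "shortest_path N f k p \<longleftrightarrow> minimal_at (demand_paths N k) (cost f) (cost g) 0 p"
  by (simp add: shortest_path_def minimal_at_def)

lemma shortest_path_combined:
  "shortest_path N (\<lambda>a. f a + \<nu> * g a) k p
    \<longleftrightarrow> minimal_at (demand_paths N k) (cost f) (cost g) \<nu> p"
  by (simp add: shortest_path_def minimal_at_def cost_def sum_list_addf sum_list_const_mult)

text \<open>A shortest path for one resource consumes no more of it than the path within both bounds
  that is assumed to exist. Since the demand is not accepted on the basic topology, it is the other
  bound that breaks.\<close>

lemma shortest_path_violates:
  assumes N: "vmtr_instance N" and k: "k \<in> demands N"
  shows "shortest_path N (res1 N) k p \<Longrightarrow> bound2 N k < cost (res2 N) p"
    and "shortest_path N (res2 N) k p \<Longrightarrow> bound1 N k < cost (res1 N) p"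
proof -
  obtain p0 where p0: "p0 \<in> demand_paths N k" "within_bounds N k p0"
    using assms by (auto simp: vmtr_instance_def)
  show "shortest_path N (res1 N) k p \<Longrightarrow> bound2 N k < cost (res2 N) p"
  proof (rule ccontr)
    assume *: "shortest_path N (res1 N) k p" "\<not> bound2 N k < cost (res2 N) p"
    then have "within_bounds N k p"
      using p0 by (force simp: within_bounds_def shortest_path_def)
    then show False
      using assms * by (auto simp: vmtr_instance_def accepted_on_def)
  qed
  show "shortest_path N (res2 N) k p \<Longrightarrow> bound1 N k < cost (res1 N) p"
  proof (rule ccontr)
    assume *: "shortest_path N (res2 N) k p" "\<not> bound1 N k < cost (res1 N) p"
    then have "within_bounds N k p"
      using p0 by (force simp: within_bounds_def shortest_path_def)
    then show False
      using assms * by (auto simp: vmtr_instance_def accepted_on_def)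
  qed
qed

text \<open>At \<nu> two shortest paths tie, one on either side of the bound. Antitonicity compares
  any shortest path for another multiplier with the suitable one of the two and so decides its
  side.\<close>

lemma opt_multiplier_threshold:
  assumes fin: "finite (demand_paths N k)"
    and p0: "p0 \<in> demand_paths N k" "cost g p0 \<le> b"
    and out0: "\<And>p. shortest_path N f k p \<Longrightarrow> b < cost g p"
  defines "\<nu> \<equiv> opt_multiplier N f g b k" and "P \<equiv> demand_paths N k"
  shows "0 < \<nu>"
    and "\<exists>p. minimal_at P (cost f) (cost g) \<nu> p \<and> cost g p \<le> b"
    and "\<mu> < \<nu> \<Longrightarrow> minimal_at P (cost f) (cost g) \<mu> p \<Longrightarrow> b < cost g p"
    and "\<nu> < \<mu> \<Longrightarrow> minimal_at P (cost f) (cost g) \<mu> p \<Longrightarrow> cost g p \<le> b"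
proof -
  obtain \<nu>' r s where *: "0 < \<nu>'" "minimal_at P (cost f) (cost g) \<nu>' r" "cost g r \<le> b"
    "minimal_at P (cost f) (cost g) \<nu>' s" "b < cost g s"
  proof (rule critical_multiplier[of P p0 "cost g" b "cost f"])
    show "b < cost g p" if "minimal_at P (cost f) (cost g) 0 p" for p
      using that by (intro out0) (simp add: P_def shortest_path_iff_minimal_at[of _ _ _ _ g])
  qed (use fin p0 in \<open>auto simp: P_def\<close>)
  have "\<nu> = \<nu>'"
    unfolding \<nu>_def using * fin unfolding P_def by (intro opt_multiplier_eqI) auto
  then show "0 < \<nu>" "\<exists>p. minimal_at P (cost f) (cost g) \<nu> p \<and> cost g p \<le> b"
    using * by auto
  show "b < cost g p" if "\<mu> < \<nu>" "minimal_at P (cost f) (cost g) \<mu> p"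
    using minimal_at_antimono[OF that(2) *(4)] that *(5) \<open>\<nu> = \<nu>'\<close> by auto
  show "cost g p \<le> b" if "\<nu> < \<mu>" "minimal_at P (cost f) (cost g) \<mu> p"
    using minimal_at_antimono[OF *(2) that(2)] that *(3) \<open>\<nu> = \<nu>'\<close> by auto
qed

context
  fixes N :: "('v, 'a, 'k) vmtr" and k
  assumes N: "vmtr_instance N" and k: "k \<in> demands N"
begin

private abbreviation "P \<equiv> demand_paths N k"
private abbreviation "short \<nu> p \<equiv> minimal_at P (cost (res1 N)) (cost (res2 N)) \<nu> p"

private lemma within_path:
  obtains p where "p \<in> P" "cost (res1 N) p \<le> bound1 N k" "cost (res2 N) p \<le> bound2 N k"
  using N k by (auto simp: vmtr_instance_def within_bounds_def)

private lemma covers_iff_minimal: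
  "covers N \<nu> k \<longleftrightarrow>
    (\<exists>p. short \<nu> p \<and> cost (res1 N) p \<le> bound1 N k \<and> cost (res2 N) p \<le> bound2 N k)"
  by (auto simp: covers_def accepted_on_def shortest_path_combined within_bounds_def)

lemma lam_min_threshold:
  shows lam_min_pos: "0 < lam_min N k"
    and "\<exists>p. short (lam_min N k) p \<and> cost (res2 N) p \<le> bound2 N k"
    and "\<mu> < lam_min N k \<Longrightarrow> short \<mu> p \<Longrightarrow> bound2 N k < cost (res2 N) p"
    and "lam_min N k < \<mu> \<Longrightarrow> short \<mu> p \<Longrightarrow> cost (res2 N) p \<le> bound2 N k"
proof -
  obtain p0 where p0: "p0 \<in> P" "cost (res2 N) p0 \<le> bound2 N k"
    using within_path by blast
  note * = opt_multiplier_threshold[where f = "res1 N" and g = "res2 N" and b = "bound2 N k",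
      OF finite_demand_paths[OF N] p0 shortest_path_violates(1)[OF N k], folded lam_min_def]
  show "0 < lam_min N k" "\<exists>p. short (lam_min N k) p \<and> cost (res2 N) p \<le> bound2 N k"
    "\<mu> < lam_min N k \<Longrightarrow> short \<mu> p \<Longrightarrow> bound2 N k < cost (res2 N) p"
    "lam_min N k < \<mu> \<Longrightarrow> short \<mu> p \<Longrightarrow> cost (res2 N) p \<le> bound2 N k"
    using * by blast+
qed

text \<open>The thresholds with the resources exchanged, read through the reciprocal, which reverses
  the order of the positive multipliers.\<close>

lemma lam_max_threshold:
  shows lam_max_pos: "0 < lam_max N k"
    and "\<exists>p. short (lam_max N k) p \<and> cost (res1 N) p \<le> bound1 N k"
    and "lam_max N k < \<mu> \<Longrightarrow> short \<mu> p \<Longrightarrow> bound1 N k < cost (res1 N) p"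
    and "0 < \<mu> \<Longrightarrow> \<mu> < lam_max N k \<Longrightarrow> short \<mu> p \<Longrightarrow> cost (res1 N) p \<le> bound1 N k"
proof -
  obtain p0 where p0: "p0 \<in> P" "cost (res1 N) p0 \<le> bound1 N k"
    using within_path by blast
  define \<nu> where "\<nu> = opt_multiplier N (res2 N) (res1 N) (bound1 N k) k"
  note * = opt_multiplier_threshold[where f = "res2 N" and g = "res1 N" and b = "bound1 N k",
      OF finite_demand_paths[OF N] p0 shortest_path_violates(2)[OF N k], folded \<nu>_def]
  have max: "lam_max N k = 1 / \<nu>"
    by (simp add: lam_max_def \<nu>_def)
  show pos: "0 < lam_max N k"
    using *(1) max by simp
  show "\<exists>p. short (lam_max N k) p \<and> cost (res1 N) p \<le> bound1 N k"
    using *(2) pos minimal_at_inverse[OF pos, of P "cost (res2 N)" "cost (res1 N)"] max by simp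
  show "bound1 N k < cost (res1 N) p" if "lam_max N k < \<mu>" "short \<mu> p"
  proof -
    have "0 < \<mu>"
      using that pos by simp
    moreover have "1 / \<mu> < \<nu>"
      using that *(1) \<open>0 < \<mu>\<close> max by (simp add: field_simps)
    ultimately show ?thesis
      using *(3)[of "1 / \<mu>" p] that by (simp add: minimal_at_inverse)
  qed
  show "cost (res1 N) p \<le> bound1 N k" if "0 < \<mu>" "\<mu> < lam_max N k" "short \<mu> p"
  proof -
    have "\<nu> < 1 / \<mu>"
      using that *(1) max by (simp add: field_simps)
    then show ?thesis
      using *(4)[of "1 / \<mu>" p] that by (simp add: minimal_at_inverse)
  qed
qed

lemma covers_imp_between:
  assumes "0 \<le> \<nu>" and "covers N \<nu> k"
  shows "lam_min N k \<le> \<nu>" and "\<nu> \<le> lam_max N k"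
proof -
  obtain p where p: "short \<nu> p" "cost (res1 N) p \<le> bound1 N k" "cost (res2 N) p \<le> bound2 N k"
    using assms by (auto simp: covers_iff_minimal)
  show "lam_min N k \<le> \<nu>"
    using lam_min_threshold(3)[of \<nu> p] p by (meson linorder_not_le)
  show "\<nu> \<le> lam_max N k"
    using lam_max_threshold(3)[of \<nu> p] p by (meson linorder_not_le)
qed

text \<open>One bound holds for all shortest paths, so a single witness for the other bound
  suffices: at the upper end all are within bound 2, below it all are within bound 1. In an interval
  of one point neither is known for all, and the two witnesses may differ.\<close>

lemma covers_if_between:
  assumes "lam_min N k \<le> \<nu>" and "\<nu> \<le> lam_max N k" and "lam_min N k < lam_max N k"
  shows "covers N \<nu> k"
proof (cases "\<nu> = lam_max N k")
  case True
  then show ?thesis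
    using lam_max_threshold(2) lam_min_threshold(4)[of \<nu>] assms(3)
    unfolding covers_iff_minimal by blast
next
  case False
  obtain p where p: "short \<nu> p" "cost (res2 N) p \<le> bound2 N k"
  proof (cases "\<nu> = lam_min N k")
    case True
    then show thesis
      using lam_min_threshold(2) that by blast
  next
    case False
    have "P \<noteq> {}"
      using within_path by blast
    then obtain p where "short \<nu> p"
      using minimal_at_exists[OF finite_demand_paths[OF N]] by blast
    then show thesis
      using lam_min_threshold(4)[of \<nu> p] False assms(1) that by simp
  qed
  moreover have "cost (res1 N) p \<le> bound1 N k"
    using lam_max_threshold(4)[of \<nu> p] p False assms lam_min_pos by simp
  ultimately show ?thesis
    unfolding covers_iff_minimal by blast
qed

end

lemma covers_iff:
  assumes "vmtr_instance N" "degenerate_feasible N" "k \<in> demands N" "0 \<le> \<nu>"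
  shows "covers N \<nu> k \<longleftrightarrow> lam_min N k \<le> \<nu> \<and> \<nu> \<le> lam_max N k"
proof (cases "lam_min N k < lam_max N k")
  case True
  then show ?thesis
    using covers_imp_between[OF assms(1,3,4)] covers_if_between[OF assms(1,3), of \<nu>] by blast
next
  case False
  then have "\<nu> = lam_min N k" "lam_min N k = lam_max N k"
    if "lam_min N k \<le> \<nu> \<and> \<nu> \<le> lam_max N k"
    using that by auto
  then show ?thesis
    using covers_imp_between[OF assms(1,3,4)] assms(2,3) by (metis degenerate_feasible_def)
qed

lemma vmtr_step_eq:
  assumes N: "vmtr_instance N" "degenerate_feasible N" and l: "l \<in> lam_max N ` remaining N"
  shows "{k \<in> remaining N. covers N l k}
    = {k \<in> remaining N. lam_min N k \<le> l \<and> l \<le> lam_max N k}"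
proof -
  have "0 \<le> l"
    using l lam_max_pos[OF N(1)] by (force simp: remaining_def)
  then show ?thesis
    using covers_iff[OF N] by (auto simp: remaining_def)
qed

section \<open>The greedy loop\<close>

text \<open>Minimality is a loop invariant quantified over all covers \<open>M\<close>: at least
  \<open>card L\<close> elements of \<open>M\<close> lie at or below a chosen multiplier. Counting
  only these leaves the later elements of \<open>M\<close> to be charged to later
  multipliers.\<close>

lemma vmtr_algorithm_correct:
  assumes N: "vmtr_instance N" "degenerate_feasible N"
  obtains L where "vmtr_algorithm N = Some L" "finite L" "L \<subseteq> {0..}"
    "\<And>k. k \<in> remaining N \<Longrightarrow> \<exists>\<nu> \<in> L. covers N \<nu> k"
    "\<And>M. finite M \<Longrightarrow> M \<subseteq> {0..} \<Longrightarrow> (\<And>k. k \<in> remaining N \<Longrightarrow> \<exists>\<nu> \<in> M. covers N \<nu> k)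
      \<Longrightarrow> card L \<le> card M"
proof -
  define b where "b = (\<lambda>(Kbar, L :: real set). remaining N - Kbar \<noteq> {})"
  define below where "below M L = {m \<in> M. \<exists>l \<in> L. m \<le> l}" for M L :: "real set"
  define cover where "cover M \<longleftrightarrow> finite M \<and> M \<subseteq> {0..} \<and> (\<forall>k \<in> remaining N. \<exists>\<nu> \<in> M. covers N \<nu> k)" for M
  define inv where "inv = (\<lambda>(Kbar, L). finite L \<and> L \<subseteq> {0..} \<and>
    (\<forall>k \<in> remaining N \<inter> Kbar. \<exists>l \<in> L. covers N l k) \<and>
    (\<forall>k \<in> remaining N - Kbar. \<forall>l \<in> L. l < lam_min N k) \<and>
    (\<forall>M. cover M \<longrightarrow> card L \<le> card (below M L)))"
  have fin: "finite (remaining N)"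
    using N by (simp add: vmtr_instance_def remaining_def)
  have step: "inv (vmtr_step N s) \<and>
    card (remaining N - fst (vmtr_step N s)) < card (remaining N - fst s)"
    if s: "inv s" "b s" for s
  proof -
    obtain Kbar L where sKL: "s = (Kbar, L)"
      by force
    define R where "R = remaining N - Kbar"
    have R: "finite R" "R \<noteq> {}"
      using fin s sKL by (auto simp: R_def b_def)
    define l where "l = Min (lam_max N ` R)"
    have "l \<in> lam_max N ` R"
      using R unfolding l_def by (intro Min_in) auto
    then obtain w where w: "w \<in> R" "l = lam_max N w"
      by auto
    have l_le: "l \<le> lam_max N k" if "k \<in> R" for k
      using R that by (simp add: l_def)
    have "0 \<le> l"
      using w lam_max_pos[OF N(1), of w] by (auto simp: R_def remaining_def)
    define C where "C = {k \<in> remaining N. covers N l k}"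
    have C: "C = {k \<in> remaining N. lam_min N k \<le> l \<and> l \<le> lam_max N k}"
      using vmtr_step_eq[OF N, of l] w by (auto simp: C_def R_def)
    \<comment> \<open>The interval of \<open>w\<close> contains its own upper end, so every
      iteration makes progress.\<close>
    have "w \<in> C"
      using w by (auto simp: C R_def remaining_def)
    have eq: "vmtr_step N s = (Kbar \<union> C, insert l L)"
      by (simp add: vmtr_step_def sKL Let_def C_def l_def R_def)
    have inv_s: "finite L" "L \<subseteq> {0..}" "\<forall>k \<in> remaining N \<inter> Kbar. \<exists>l \<in> L. covers N l k"
      "\<forall>k \<in> R. \<forall>l \<in> L. l < lam_min N k" "\<forall>M. cover M \<longrightarrow> card L \<le> card (below M L)"
      using s by (auto simp: inv_def sKL R_def)
    have L_less: "l' < lam_min N w" if "l' \<in> L" for l'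
      using inv_s w that by auto
    have "lam_min N w \<le> l"
      using w by (auto simp: R_def remaining_def)
    have "l \<notin> L"
      using L_less[of l] \<open>lam_min N w \<le> l\<close> by auto
    have "card (insert l L) \<le> card (below M (insert l L))" if M: "cover M" for M
    proof -
      obtain \<nu> where \<nu>: "\<nu> \<in> M" "covers N \<nu> w"
        using M w by (auto simp: cover_def R_def)
      have "0 \<le> \<nu>" "finite M"
        using M \<nu> by (auto simp: cover_def)
      then have "lam_min N w \<le> \<nu>" "\<nu> \<le> l"
        using \<nu> w covers_imp_between[OF N(1), of w \<nu>] by (auto simp: R_def remaining_def)
      \<comment> \<open>\<nu> is at least \<open>lam_min N w\<close>, hence above all of
        \<open>L\<close>, and at most \<open>l\<close>: it is counted now and was not counted
        before.\<close>
      then have "insert \<nu> (below M L) \<subseteq> below M (insert l L)" "\<nu> \<notin> below M L"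
        using \<nu> L_less by (force simp: below_def)+
      moreover have "finite (below M L)" "finite (below M (insert l L))"
        using \<open>finite M\<close> by (auto simp: below_def)
      ultimately have "Suc (card (below M L)) \<le> card (below M (insert l L))"
        by (metis card_insert_disjoint card_mono)
      then show ?thesis
        using inv_s M \<open>l \<notin> L\<close> by fastforce
    qed
    \<comment> \<open>\<open>l\<close> is the least upper end that is left, so an interval missed by
      \<open>l\<close> starts beyond it.\<close>
    moreover have "l < lam_min N k" if "k \<in> remaining N - (Kbar \<union> C)" for k
      using that l_le[of k] by (auto simp: C R_def)
    ultimately have "inv (Kbar \<union> C, insert l L)"
      using inv_s \<open>0 \<le> l\<close> by (auto simp: inv_def C_def R_def)
    moreover have "remaining N - (Kbar \<union> C) \<subset> R"
      using w \<open>w \<in> C\<close> by (auto simp: R_def)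
    ultimately show ?thesis
      using R by (simp add: eq[unfolded sKL] sKL psubset_card_mono R_def)
  qed
  have inv0: "inv ({}, {})"
    by (auto simp: inv_def)
  obtain t where t: "while_option b (vmtr_step N) ({}, {}) = Some t"
    using measure_while_option_Some[of inv b "vmtr_step N" "\<lambda>s. card (remaining N - fst s)"]
      step inv0 by blast
  obtain Kbar L where tKL: "t = (Kbar, L)"
    by force
  have "inv t"
    using while_option_rule[of inv b "vmtr_step N", OF _ t inv0] step by blast
  moreover have "\<not> b t"
    using while_option_stop[OF t] .
  ultimately have *: "remaining N \<subseteq> Kbar" "finite L" "L \<subseteq> {0..}"
    "\<forall>k \<in> remaining N. \<exists>l \<in> L. covers N l k" "\<And>M. cover M \<Longrightarrow> card L \<le> card (below M L)"
    by (auto simp: inv_def b_def tKL)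
  show thesis
  proof (rule that)
    show "vmtr_algorithm N = Some L"
      using t by (simp add: vmtr_algorithm_def b_def tKL)
    show "card L \<le> card M"
      if "finite M" "M \<subseteq> {0..}" "\<And>k. k \<in> remaining N \<Longrightarrow> \<exists>\<nu> \<in> M. covers N \<nu> k" for M
    proof -
      have "card L \<le> card (below M L)"
        using that by (intro *) (auto simp: cover_def)
      also have "\<dots> \<le> card M"
        using that by (intro card_mono) (auto simp: below_def)
      finally show ?thesis .
    qed
  qed (use * in auto)
qed

section \<open>Optimality for both objectives\<close>

lemma accepted_subset_remaining:
  assumes "vmtr_instance N" and "M \<subseteq> {0..}"
  shows "accepted N M \<subseteq> remaining N"
  using covers_imp_between[OF assms(1)] assms(2)
  by (force simp: accepted_def remaining_def)

text \<open>Only remaining demands can be accepted and \<open>L\<close> accepts all of them. A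
  competitor thus either accepts strictly fewer demands or is itself a cover of
  \<open>remaining N\<close>, and then minimality of \<open>L\<close> among covers applies.\<close>

lemma vmtr_algorithm_exact:
  assumes N: "vmtr_instance N" "degenerate_feasible N"
  obtains L where "vmtr_algorithm N = Some L" "optimal_design N L"
    "\<And>k \<nu>. k \<in> demands N - remaining N \<Longrightarrow> 0 \<le> \<nu> \<Longrightarrow> \<not> covers N \<nu> k"
    "\<And>k. k \<in> remaining N \<Longrightarrow> \<exists>\<nu> \<in> L. covers N \<nu> k"
    "\<And>M. finite M \<Longrightarrow> M \<subseteq> {0..} \<Longrightarrow> (\<And>k. k \<in> remaining N \<Longrightarrow> \<exists>\<nu> \<in> M. covers N \<nu> k)
      \<Longrightarrow> card L \<le> card M"
proof -
  obtain L where L: "vmtr_algorithm N = Some L" "finite L" "L \<subseteq> {0..}"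
    "\<And>k. k \<in> remaining N \<Longrightarrow> \<exists>\<nu> \<in> L. covers N \<nu> k"
    "\<And>M. finite M \<Longrightarrow> M \<subseteq> {0..} \<Longrightarrow> (\<And>k. k \<in> remaining N \<Longrightarrow> \<exists>\<nu> \<in> M. covers N \<nu> k)
      \<Longrightarrow> card L \<le> card M"
    using vmtr_algorithm_correct[OF N] by blast
  have fin: "finite (remaining N)"
    using N by (simp add: vmtr_instance_def remaining_def)
  have acc: "accepted N L = remaining N"
    using accepted_subset_remaining[OF N(1) L(3)] L(4) by (auto simp: accepted_def remaining_def)
  have "optimal_design N L"
    unfolding optimal_design_def
  proof (intro conjI allI impI)
    fix M :: "real set" assume M: "finite M" "M \<subseteq> {0..}"
    have sub: "accepted N M \<subseteq> remaining N"
      using accepted_subset_remaining[OF N(1) M(2)] .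
    show "card (accepted N M) < card (accepted N L) \<or>
      card (accepted N M) = card (accepted N L) \<and> card L \<le> card M"
    proof (cases "accepted N M = remaining N")
      case True
      then have "card L \<le> card M"
        using M by (intro L(5)) (auto simp: accepted_def)
      then show ?thesis
        using True acc by simp
    next
      case False
      then show ?thesis
        using sub fin acc by (simp add: psubset_card_mono psubset_eq)
    qed
  qed (use L in auto)
  moreover have "\<not> covers N \<nu> k" if "k \<in> demands N - remaining N" "0 \<le> \<nu>" for k \<nu>
    using that covers_imp_between[OF N(1), of k \<nu>] by (auto simp: remaining_def)
  ultimately show thesis
    using L that by blast
qed

section \<open>The greedy loop on lists of intervals\<close>

function greedy :: "(rat \<times> rat) list \<Rightarrow> rat list" where
  "greedy [] = []"
| "greedy (k # ks) = snd k # greedy (filter (\<lambda>j. \<not> (fst j \<le> snd k \<and> snd k \<le> snd j)) ks)"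
  by pat_completeness auto
termination
  by (relation "measure length") (auto simp: less_Suc_eq_le)

definition real_interval :: "rat \<times> rat \<Rightarrow> real \<times> real" where
  "real_interval j = (real_of_rat (fst j), real_of_rat (snd j))"

text \<open>List and demands are tied only through their sets of intervals: demands with equal
  intervals are covered together, and \<open>Min\<close> sees only the set of upper ends. Sortedness
  puts that minimum at the head.\<close>

lemma while_option_eq_greedy:
  assumes N: "vmtr_instance N" "degenerate_feasible N"
  assumes "sorted (map snd ks)"
    and "(\<lambda>k. (lam_min N k, lam_max N k)) ` (remaining N - Kbar) = real_interval ` set ks"
  shows "\<exists>K. while_option (\<lambda>(Kbar, L). remaining N - Kbar \<noteq> {}) (vmtr_step N) (Kbar, L)
    = Some (K, L \<union> real_of_rat ` set (greedy ks))"
  using assms(3,4)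
proof (induction ks arbitrary: Kbar L rule: greedy.induct)
  case 1
  then show ?case
    by (simp add: while_option_unfold)
next
  case (2 k ks)
  note greedy_Cons = greedy.simps(2)[of k ks]
  define R where "R = remaining N - Kbar"
  define l where "l = Min (lam_max N ` R)"
  let ?int = "\<lambda>k. (lam_min N k, lam_max N k)"
  define ks' where "ks' = filter (\<lambda>j. \<not> (fst j \<le> snd k \<and> snd k \<le> snd j)) ks"
  have img: "?int ` R = real_interval ` set (k # ks)"
    using "2.prems" by (simp add: R_def)
  have R: "finite R" "R \<noteq> {}"
    using N img by (auto simp: R_def vmtr_instance_def remaining_def)
  have "lam_max N ` R = snd ` ?int ` R"
    by force
  also have "\<dots> = real_of_rat ` snd ` set (k # ks)"
    unfolding img by (force simp: real_interval_def)
  finally have max: "lam_max N ` R = real_of_rat ` snd ` set (k # ks)" .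
  have l: "l = real_of_rat (snd k)"
    unfolding l_def max using "2.prems"(1)
    by (intro Min_eqI) (auto simp: of_rat_less_eq)
  have lR: "l \<in> lam_max N ` remaining N"
    using max l by (auto simp: R_def)
  define C where "C = {k \<in> remaining N. covers N l k}"
  have C: "C = {k \<in> remaining N. lam_min N k \<le> l \<and> l \<le> lam_max N k}"
    using vmtr_step_eq[OF N lR] by (simp add: C_def)
  have step: "vmtr_step N (Kbar, L) = (Kbar \<union> C, insert l L)"
    by (simp add: vmtr_step_def Let_def C_def l_def R_def)
  \<comment> \<open>\<open>greedy\<close> drops its head without a test. The loop does the same
    because the interval of a remaining demand is nonempty and so contains its upper end.\<close>
  have head: "fst k \<le> snd k"
  proof -
    have "real_interval k \<in> ?int ` R"
      using img by auto
    then show ?thesis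
      by (auto simp: real_interval_def R_def remaining_def) (metis of_rat_less_eq)
  qed
  \<comment> \<open>A condition on intervals alone, so that removing covered demands and filtering
    the list become the same intersection with \<open>Q\<close>.\<close>
  define Q where "Q = {(x, y). \<not> (x \<le> l \<and> l \<le> y)}"
  have "?int ` (remaining N - (Kbar \<union> C)) = ?int ` R \<inter> Q"
    by (auto simp: R_def C Q_def)
  also have "\<dots> = real_interval ` {j \<in> set (k # ks). real_interval j \<in> Q}"
    unfolding img by auto
  also have "{j \<in> set (k # ks). real_interval j \<in> Q} = set ks'"
    using head by (auto simp: ks'_def Q_def real_interval_def l of_rat_less_eq)
  finally have img': "?int ` (remaining N - (Kbar \<union> C)) = real_interval ` set ks'" .
  have "sorted (map snd ks')"
    using "2.prems"(1) by (simp add: ks'_def sorted_filter)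
  then obtain K where "while_option (\<lambda>(Kbar, L). remaining N - Kbar \<noteq> {}) (vmtr_step N)
    (Kbar \<union> C, insert l L) = Some (K, insert l L \<union> real_of_rat ` set (greedy ks'))"
    using "2.IH"[of "Kbar \<union> C" "insert l L"] img' unfolding ks'_def by blast
  then show ?case
    using R(2)
    by (subst while_option_unfold) (simp add: step R_def l greedy_Cons[folded ks'_def] del: greedy.simps)
qed

lemma vmtr_algorithm_eq_greedy:
  assumes "vmtr_instance N" "degenerate_feasible N"
    and "sorted (map snd ks)"
    and "(\<lambda>k. (lam_min N k, lam_max N k)) ` remaining N = real_interval ` set ks"
  shows "vmtr_algorithm N = Some (real_of_rat ` set (greedy ks))"
  using while_option_eq_greedy[of N ks "{}" "{}"] assms by (auto simp: vmtr_algorithm_def)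

section \<open>Running times and bit lengths\<close>

text \<open>Total correctness with a cost: termination, result and time are proved in one induction,
  since the time of an operation depends on size bounds for the intermediate results.\<close>

definition runs :: "'x timed \<Rightarrow> ('x \<Rightarrow> bool) \<Rightarrow> nat \<Rightarrow> bool" where
  "runs m P t \<longleftrightarrow> (\<exists>x u. m = Some (x, u) \<and> P x \<and> u \<le> t)"

lemma runs_ret: "P x \<Longrightarrow> 1 \<le> t \<Longrightarrow> runs (ret x) P t"
  by (simp add: runs_def ret_def)

lemma runs_bind:
  assumes "runs m P t" and "\<And>x. P x \<Longrightarrow> runs (f x) Q t'" and "t + t' \<le> T"
  shows "runs (tbind m f) Q T"
proof -
  obtain x u where "m = Some (x, u)" "P x" "u \<le> t"
    using assms(1) by (auto simp: runs_def)
  moreover obtain y v where "f x = Some (y, v)" "Q y" "v \<le> t'"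
    using assms(2)[OF \<open>P x\<close>] by (auto simp: runs_def)
  ultimately show ?thesis
    using assms(3) by (auto simp: runs_def tbind_def)
qed

lemma runs_mono:
  assumes "runs m P t" and "\<And>x. P x \<Longrightarrow> Q x" and "t \<le> t'"
  shows "runs m Q t'"
  using assms by (force simp: runs_def)

lemma runs_lookup: "i < length xs \<Longrightarrow> runs (lookup xs i) (\<lambda>y. y = xs ! i) (length xs)"
proof (induction xs i rule: lookup.induct)
  case (3 x xs i)
  then show ?case
    by (auto intro!: runs_bind[OF "3.IH", where t' = 1] runs_ret)
qed (auto intro!: runs_ret)

lemma runs_update: "runs (update xs i y) (\<lambda>ys. ys = xs[i := y]) (Suc (length xs))"
proof (induction xs i y rule: update.induct)
  case (3 x xs i y)
  then show ?case
    by (auto intro!: runs_bind[OF "3.IH", where t' = 1] runs_ret)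
qed (auto intro!: runs_ret)

lemma runs_copies: "runs (copies n x) (\<lambda>xs. xs = replicate n x) (Suc n)"
proof (induction n x rule: copies.induct)
  case (2 n x)
  then show ?case
    by (auto intro!: runs_bind[OF "2.IH", where t' = 1] runs_ret)
qed (auto intro!: runs_ret)

section \<open>Bit lengths of rational numbers\<close>

definition rat_bound :: "nat \<Rightarrow> rat \<Rightarrow> bool" where
  "rat_bound M q \<longleftrightarrow>
    (\<exists>a b. q = of_int a / of_int b \<and> 0 < b \<and> \<bar>a\<bar> \<le> 2 ^ M \<and> b \<le> 2 ^ M)"

lemma rat_boundI:
  assumes "of_int b * q = of_int a" and "0 < b" "\<bar>a\<bar> \<le> 2 ^ M" "b \<le> 2 ^ M"
  shows "rat_bound M q"
proof -
  have "q = of_int a / of_int b"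
    using assms(1,2) by (simp add: field_simps)
  then show ?thesis
    using assms unfolding rat_bound_def by blast
qed

text \<open>The extra bit is for \<open>a = 2 ^ M\<close> itself.\<close>

lemma bitlen_le_of_le_power:
  assumes "(a :: int) \<le> 2 ^ M"
  shows "nat (bitlen a) \<le> Suc M"
proof -
  have "(2 :: int) ^ M < 2 ^ Suc M"
    by simp
  then have "a < 2 ^ Suc M"
    using assms by linarith
  then have "bitlen a \<le> int (Suc M)"
    by (subst bitlen_le_iff_power) (simp add: nat_add_distrib)
  then show ?thesis
    by simp
qed

text \<open>By coprimality the reduced numerator and denominator divide those of any other
  representation. This is why \<open>rat_bound\<close> may speak of unreduced fractions, whose sizes
  are easy to follow through arithmetic.\<close>

lemma rat_bits_le:
  assumes "rat_bound M q"
  shows "rat_bits q \<le> 2 * M + 2"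
proof -
  obtain a b where ab: "q = of_int a / of_int b" "0 < b" "\<bar>a\<bar> \<le> 2 ^ M" "b \<le> 2 ^ M"
    using assms by (auto simp: rat_bound_def)
  obtain c d where cd: "quotient_of q = (c, d)"
    by force
  have "0 < d" "coprime c d" "q = of_int c / of_int d"
    using cd quotient_of_denom_pos quotient_of_coprime quotient_of_div by blast+
  then have "of_int (a * d) = (of_int (c * b) :: rat)"
    using ab by (simp add: field_simps)
  then have eq: "a * d = c * b"
    by (simp only: of_int_eq_iff)
  have "d dvd b"
    using eq \<open>coprime c d\<close> by (metis coprime_commute coprime_dvd_mult_right_iff dvd_triv_right)
  then have "d \<le> b"
    using ab by (simp add: zdvd_imp_le)
  have "\<bar>c\<bar> \<le> \<bar>a\<bar>"
  proof (cases "a = 0")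
    case True
    then show ?thesis
      using eq ab by simp
  next
    case False
    have "c dvd a"
      using eq \<open>coprime c d\<close> by (metis coprime_dvd_mult_left_iff dvd_triv_left)
    then show ?thesis
      using False by (simp add: dvd_imp_le_int)
  qed
  then have "nat (bitlen \<bar>c\<bar>) \<le> Suc M" "nat (bitlen d) \<le> Suc M"
    using ab \<open>d \<le> b\<close> by (intro bitlen_le_of_le_power; linarith)+
  then show ?thesis
    using cd by (simp add: rat_bits_def)
qed

lemma less_power_bitlen: "(a :: int) < 2 ^ nat (bitlen a)"
proof (cases "0 < a")
  case True
  then show ?thesis
    using bitlen_bounds by blast
next
  case False
  then have "a \<le> 0"
    by simp
  also have "(0 :: int) < 2 ^ nat (bitlen a)"
    by simp
  finally show ?thesis .
qed

definition denom :: "rat \<Rightarrow> int" where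
  "denom q = snd (quotient_of q)"

lemma denom_mult: "of_int (denom q) * q = of_int (fst (quotient_of q))"
proof -
  have "q = of_int (fst (quotient_of q)) / of_int (denom q)"
    unfolding denom_def by (metis prod.collapse quotient_of_div)
  moreover have "denom q > 0"
    by (simp add: denom_def quotient_of_denom_pos')
  ultimately show ?thesis
    by (simp add: field_simps)
qed

lemma denom_pos: "0 < denom q"
  by (simp add: denom_def quotient_of_denom_pos')

lemma rat_bits_eq: "rat_bits q = nat (bitlen \<bar>fst (quotient_of q)\<bar>) + nat (bitlen (denom q))"
  by (simp add: rat_bits_def denom_def case_prod_beta)

lemma denom_le: "denom q \<le> 2 ^ rat_bits q"
proof -
  have "denom q \<le> 2 ^ nat (bitlen (denom q))"
    using less_power_bitlen by (rule less_imp_le)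
  also have "\<dots> \<le> 2 ^ rat_bits q"
    by (intro power_increasing) (auto simp: rat_bits_eq)
  finally show ?thesis .
qed

lemma rat_bound_rat_bits: "rat_bound (rat_bits q) q"
proof (rule rat_boundI[OF denom_mult denom_pos])
  have "\<bar>fst (quotient_of q)\<bar> \<le> 2 ^ nat (bitlen \<bar>fst (quotient_of q)\<bar>)"
    using less_power_bitlen by (rule less_imp_le)
  also have "\<dots> \<le> 2 ^ rat_bits q"
    by (intro power_increasing) (auto simp: rat_bits_eq)
  finally show "\<bar>fst (quotient_of q)\<bar> \<le> 2 ^ rat_bits q" .
qed (rule denom_le)

lemma rat_bound_mono:
  assumes "rat_bound M q" "M \<le> M'"
  shows "rat_bound M' q"
proof -
  obtain a b where "q = of_int a / of_int b" "0 < b" "\<bar>a\<bar> \<le> 2 ^ M" "b \<le> 2 ^ M"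
    using assms(1) by (auto simp: rat_bound_def)
  moreover have "(2 :: int) ^ M \<le> 2 ^ M'"
    using assms(2) by (simp add: power_increasing)
  ultimately show ?thesis
    by (intro rat_boundI[of b q a])
      (simp, simp, rule order_trans, assumption+, rule order_trans, assumption+)
qed

lemma rat_bound_0: "rat_bound M 0" and rat_bound_1: "rat_bound M 1"
  by (rule rat_boundI[of 1 _ 0]; simp) (rule rat_boundI[of 1 _ 1]; simp)

lemma rat_bound_abs_le:
  assumes "rat_bound M q"
  shows "\<bar>q\<bar> \<le> 2 ^ M"
proof -
  obtain a b where ab: "q = of_int a / of_int b" "0 < b" "\<bar>a\<bar> \<le> 2 ^ M"
    using assms by (auto simp: rat_bound_def)
  have "\<bar>q\<bar> = of_int \<bar>a\<bar> / of_int b"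
    using ab by simp
  also have "\<dots> \<le> of_int \<bar>a\<bar> / 1"
    using ab by (intro divide_left_mono) auto
  also have "\<dots> \<le> of_int (2 ^ M)"
    using ab by (simp only: div_by_1 of_int_le_iff)
  finally show ?thesis
    by simp
qed

lemma rat_bound_minus: "rat_bound M q \<Longrightarrow> rat_bound M (- q)"
  unfolding rat_bound_def by (metis abs_minus minus_divide_left of_int_minus)

lemma rat_bound_mult:
  assumes "rat_bound M p" "rat_bound K q"
  shows "rat_bound (M + K) (p * q)"
proof -
  obtain a b where ab: "p = of_int a / of_int b" "0 < b" "\<bar>a\<bar> \<le> 2 ^ M" "b \<le> 2 ^ M"
    using assms(1) by (auto simp: rat_bound_def)
  obtain c d where cd: "q = of_int c / of_int d" "0 < d" "\<bar>c\<bar> \<le> 2 ^ K" "d \<le> 2 ^ K"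
    using assms(2) by (auto simp: rat_bound_def)
  show ?thesis
  proof (rule rat_boundI[of "b * d" _ "a * c"])
    show "\<bar>a * c\<bar> \<le> 2 ^ (M + K)" "b * d \<le> 2 ^ (M + K)"
      using ab cd by (simp_all add: abs_mult power_add mult_mono)
  qed (use ab cd in simp_all)
qed

text \<open>The additional bit absorbs the sum of two products in the numerator.\<close>

lemma rat_bound_add:
  assumes "rat_bound M p" "rat_bound K q"
  shows "rat_bound (M + K + 1) (p + q)"
proof -
  obtain a b where ab: "p = of_int a / of_int b" "0 < b" "\<bar>a\<bar> \<le> 2 ^ M" "b \<le> 2 ^ M"
    using assms(1) by (auto simp: rat_bound_def)
  obtain c d where cd: "q = of_int c / of_int d" "0 < d" "\<bar>c\<bar> \<le> 2 ^ K" "d \<le> 2 ^ K"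
    using assms(2) by (auto simp: rat_bound_def)
  have *: "\<bar>a\<bar> * d \<le> 2 ^ M * 2 ^ K" "b * \<bar>c\<bar> \<le> 2 ^ M * 2 ^ K" "b * d \<le> 2 ^ M * 2 ^ K"
    using ab cd by (auto intro!: mult_mono)
  show ?thesis
  proof (rule rat_boundI[of "b * d" _ "a * d + b * c"])
    have "\<bar>a * d + b * c\<bar> \<le> \<bar>a\<bar> * d + b * \<bar>c\<bar>"
      using ab cd by (metis abs_mult abs_of_pos abs_triangle_ineq)
    then show "\<bar>a * d + b * c\<bar> \<le> 2 ^ (M + K + 1)"
      using * by (simp add: power_add)
    have "b * d \<le> 2 ^ (M + K)"
      using *(3) by (simp add: power_add)
    also have "\<dots> \<le> 2 ^ (M + K + 1)"
      by simp
    finally show "b * d \<le> 2 ^ (M + K + 1)" .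
  qed (use ab cd in \<open>simp_all add: field_simps\<close>)
qed

lemma rat_bound_diff:
  "rat_bound M p \<Longrightarrow> rat_bound K q \<Longrightarrow> rat_bound (M + K + 1) (p - q)"
  using rat_bound_add[of M p K "- q"] rat_bound_minus by simp

lemma rat_bound_inverse:
  assumes "rat_bound M q"
  shows "rat_bound M (inverse q)"
proof (cases "q = 0")
  case True
  then show ?thesis
    by (simp add: rat_bound_0)
next
  case False
  obtain a b where ab: "q = of_int a / of_int b" "0 < b" "\<bar>a\<bar> \<le> 2 ^ M" "b \<le> 2 ^ M"
    using assms by (auto simp: rat_bound_def)
  have "a \<noteq> 0"
    using False ab by auto
  moreover have "inverse q = of_int b / of_int a"
    using ab by simp
  \<comment> \<open>The sign of \<open>a\<close> moves to the numerator, as \<open>rat_bound\<close>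
    asks for a positive denominator.\<close>
  ultimately have "of_int \<bar>a\<bar> * inverse q = of_int (sgn a * b)"
    by (cases "0 < a") auto
  then show ?thesis
    using ab \<open>a \<noteq> 0\<close> by (intro rat_boundI[of "\<bar>a\<bar>" _ "sgn a * b"]) (auto simp: abs_mult)
qed

lemma rat_bound_divide:
  "rat_bound M p \<Longrightarrow> rat_bound K q \<Longrightarrow> rat_bound (M + K) (p / q)"
  unfolding divide_inverse by (intro rat_bound_mult rat_bound_inverse)

text \<open>The square of \<open>4 * (M + 1)\<close>, the total length of two operands of at most
  \<open>2 * M + 2\<close> bits each.\<close>

definition op_time :: "nat \<Rightarrow> nat" where
  "op_time M = 16 * (M + 1)\<^sup>2"

lemma op_time_pos: "1 \<le> op_time M"
  by (simp add: op_time_def)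

lemma runs_rat_op:
  assumes "rat_bound M x" "rat_bound M y"
  shows "runs (rat_op f x y) (\<lambda>z. z = f x y) (op_time M)"
proof -
  have "(rat_bits x + rat_bits y)\<^sup>2 \<le> (4 * (M + 1))\<^sup>2"
    using assms[THEN rat_bits_le] by (intro power_mono) auto
  also have "\<dots> = op_time M"
    unfolding op_time_def power_mult_distrib by simp
  finally show ?thesis
    by (simp add: runs_def rat_op_def)
qed

definition wt :: "rat \<Rightarrow> rat \<Rightarrow> label \<Rightarrow> rat" where
  "wt \<alpha> \<beta> l = \<alpha> * fst l + \<beta> * snd l"

lemma rat_bound_wt:
  assumes "rat_bound A \<alpha>" "rat_bound A \<beta>" "rat_bound B (fst l)" "rat_bound B (snd l)"
    and "2 * (A + B) + 1 \<le> M"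
  shows "rat_bound M (wt \<alpha> \<beta> l)"
  unfolding wt_def
  by (rule rat_bound_mono[OF rat_bound_add[OF rat_bound_mult rat_bound_mult]])
    (use assms in \<open>auto simp: algebra_simps\<close>)

lemma runs_weight:
  assumes "rat_bound A \<alpha>" "rat_bound A \<beta>" "rat_bound B (fst l)" "rat_bound B (snd l)"
    and "2 * (A + B) + 1 \<le> M"
  shows "runs (weight \<alpha> \<beta> l) (\<lambda>w. w = wt \<alpha> \<beta> l) (3 * op_time M)"
proof -
  have ops: "rat_bound M \<alpha>" "rat_bound M \<beta>" "rat_bound M (fst l)" "rat_bound M (snd l)"
    using assms by (auto elim!: rat_bound_mono)
  have prods: "rat_bound M (\<alpha> * fst l)" "rat_bound M (\<beta> * snd l)"
    by (rule rat_bound_mono[OF rat_bound_mult], use assms in auto)+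
  show ?thesis
    unfolding weight_def wt_def
    by (rule runs_bind[OF runs_rat_op[OF ops(1,3)]],
        rule runs_bind[OF runs_rat_op[OF ops(2,4)]])
      (auto intro!: runs_rat_op prods)
qed

section \<open>Bellman--Ford\<close>

text \<open>
  With consumptions of \<open>4 * S + 1\<close> bits and multipliers of \<open>12 * S + 2\<close> bits, the weights that are
  compared have at most \<open>32 * S + 7\<close> bits.
\<close>

definition compare_bits :: "nat \<Rightarrow> nat" where
  "compare_bits S = 40 * (S + 1)"

text \<open>Two lookups and one update take at most \<open>3 * S + 1\<close> steps; two additions
  and the seven operations of \<open>improves\<close> make nine.\<close>

definition relax_time :: "nat \<Rightarrow> nat" where
  "relax_time S = 3 * S + 1 + 9 * op_time (compare_bits S)"

definition bf_time :: "nat \<Rightarrow> nat" where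
  "bf_time S = 3 * S + 3 + S * (S * relax_time S + 1)"

text \<open>The single parameter \<open>S\<close> bounds the numbers of vertices and arcs, the bit
  lengths of the weights and the exponent of a common denominator \<open>D\<close>, so all later
  bounds depend on \<open>S\<close> alone. The weights are parameters because LARAC runs with the
  resources in either order.\<close>

locale encoded_graph = fin_digraph G for G :: "(nat, nat) pre_digraph" +
  fixes n S :: nat and D :: int and w1 w2 :: "nat \<Rightarrow> rat" and es :: "arc list"
  assumes verts_eq: "verts G = {..<n}" and arcs_eq: "arcs G = {..<length es}"
    and es_nth: "i < length es \<Longrightarrow> es ! i = (tail G i, head G i, w1 i, w2 i)"
    and nonneg: "i < length es \<Longrightarrow> 0 \<le> w1 i" "i < length es \<Longrightarrow> 0 \<le> w2 i"
    and bits: "i < length es \<Longrightarrow> rat_bound S (w1 i)" "i < length es \<Longrightarrow> rat_bound S (w2 i)"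
    and n_le: "n \<le> S" and length_es_le: "length es \<le> S"
    and D_pos: "0 < D" and D_le: "D \<le> 2 ^ S"
    and D_mult: "i < length es \<Longrightarrow> of_int D * w1 i \<in> \<int>" "i < length es \<Longrightarrow> of_int D * w2 i \<in> \<int>"
begin

text \<open>Labels are pairs; quantifiers over them should stay whole.\<close>

declare split_paired_All [simp del] split_paired_Ex [simp del]

definition val :: "nat list \<Rightarrow> label" where
  "val p = (sum_list (map w1 p), sum_list (map w2 p))"

definition labels :: "nat \<Rightarrow> nat \<Rightarrow> label set" where
  "labels s t = val ` {p. apath s p t}"

text \<open>A simple path has at most \<open>2 ^ S\<close> arcs of weight at most
  \<open>2 ^ S\<close>, and multiplication by \<open>D\<close> gives an integer with
  \<open>S\<close> further bits. Thanks to the common denominator the total is \<open>3 * S\<close>,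
  whereas the bound for fractions added one by one grows with every arc.\<close>

lemma sum_arcs_bounds:
  assumes "\<And>i. i < length es \<Longrightarrow> 0 \<le> w i" "\<And>i. i < length es \<Longrightarrow> rat_bound S (w i)"
    and "\<And>i. i < length es \<Longrightarrow> of_int D * w i \<in> \<int>" and "apath s p t"
  shows "0 \<le> sum_list (map w p)" "sum_list (map w p) \<le> 2 ^ (2 * S)"
    "of_int D * sum_list (map w p) \<in> \<int>" "rat_bound (3 * S) (sum_list (map w p))"
proof -
  let ?x = "sum_list (map w p)"
  have p: "set p \<subseteq> {..<length es}" "length p \<le> n"
    using assms(4) length_apath[OF assms(4)] verts_eq arcs_eq by (auto simp: apath_def awalk_def)
  show nn: "0 \<le> ?x"
    using p assms(1) by (intro sum_list_nonneg) auto
  have "?x \<le> of_nat (length p) * 2 ^ S"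
    using p(1)
  proof (induction p)
    case (Cons e p)
    then have "w e \<le> 2 ^ S"
      using rat_bound_abs_le[OF assms(2), of e] by simp
    then show ?case
      using Cons by (simp add: algebra_simps)
  qed simp
  also have "\<dots> \<le> 2 ^ S * 2 ^ S"
  proof (rule mult_right_mono)
    have "length p \<le> 2 ^ S"
      using p(2) n_le less_exp[of S] by linarith
    then have "rat_of_nat (length p) \<le> of_nat (2 ^ S)"
      by (simp only: of_nat_le_iff)
    then show "rat_of_nat (length p) \<le> 2 ^ S"
      by simp
  qed simp
  finally show le: "?x \<le> 2 ^ (2 * S)"
    by (simp add: mult_2 power_add)
  show int: "of_int D * ?x \<in> \<int>"
    using p(1)
  proof (induction p)
    case (Cons e p)
    then show ?case
      using assms(3)[of e] by (simp add: algebra_simps)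
  qed simp
  then obtain a where a: "of_int D * ?x = of_int a"
    by (auto elim: Ints_cases)
  have "of_int \<bar>a\<bar> = of_int D * \<bar>?x\<bar>"
    using a D_pos by (metis abs_mult abs_of_pos of_int_0_less_iff of_int_abs)
  also have "\<dots> \<le> of_int (2 ^ S) * 2 ^ (2 * S)"
  proof (rule mult_mono)
    show "(of_int D :: rat) \<le> of_int (2 ^ S)"
      using D_le by (simp only: of_int_le_iff)
  qed (use nn le in auto)
  also have "\<dots> = of_int (2 ^ (3 * S))"
    by (simp flip: power_add)
  finally have "\<bar>a\<bar> \<le> 2 ^ (3 * S)"
    by (simp only: of_int_le_iff)
  moreover have "D \<le> 2 ^ (3 * S)"
    by (rule order_trans[OF D_le]) (simp add: power_increasing)
  ultimately show "rat_bound (3 * S) ?x"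
    using a D_pos by (intro rat_boundI)
qed

lemma labels_bounds:
  assumes "l \<in> labels s t"
  shows "0 \<le> fst l" "fst l \<le> 2 ^ (2 * S)" "of_int D * fst l \<in> \<int>" "rat_bound (3 * S) (fst l)"
    "0 \<le> snd l" "snd l \<le> 2 ^ (2 * S)" "of_int D * snd l \<in> \<int>" "rat_bound (3 * S) (snd l)"
proof -
  obtain p where p: "apath s p t" "l = val p"
    using assms by (auto simp: labels_def)
  then show "0 \<le> fst l" "fst l \<le> 2 ^ (2 * S)" "of_int D * fst l \<in> \<int>" "rat_bound (3 * S) (fst l)"
    "0 \<le> snd l" "snd l \<le> 2 ^ (2 * S)" "of_int D * snd l \<in> \<int>" "rat_bound (3 * S) (snd l)"
    using sum_arcs_bounds[OF nonneg(1) bits(1) D_mult(1) p(1)]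
      sum_arcs_bounds[OF nonneg(2) bits(2) D_mult(2) p(1)] by (auto simp: val_def)
qed

lemma val_snoc: "val (p @ [e]) = (fst (val p) + w1 e, snd (val p) + w2 e)"
  by (simp add: val_def)

abbreviation M :: nat where
  "M \<equiv> compare_bits S"

section \<open>The rounds of Bellman-Ford\<close>

context
  fixes s :: nat and \<alpha> \<beta> :: rat
  assumes s: "s < n" and coeffs: "0 \<le> \<alpha>" "0 \<le> \<beta>"
    and coeff_bits: "rat_bound (12 * S + 2) \<alpha>" "rat_bound (12 * S + 2) \<beta>"
begin

text \<open>Comparison by weight, with \<open>None\<close> as infinite length.\<close>

definition at_most :: "label option \<Rightarrow> label option \<Rightarrow> bool" where
  "at_most m m' \<longleftrightarrow> (\<forall>l'. m' = Some l' \<longrightarrow> (\<exists>l. m = Some l \<and> wt \<alpha> \<beta> l \<le> wt \<alpha> \<beta> l'))"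

definition path_labels :: "nat \<Rightarrow> label option list \<Rightarrow> bool" where
  "path_labels i ls \<longleftrightarrow> length ls = n \<and>
    (\<forall>v<n. \<forall>l. ls ! v = Some l \<longrightarrow> (\<exists>p. apath s p v \<and> length p \<le> i \<and> l = val p))"

text \<open>Labels belong to simple paths, which bounds their bit lengths, but compete with all
  walks, whose prefixes are again walks.\<close>

definition round_inv :: "nat \<Rightarrow> label option list \<Rightarrow> bool" where
  "round_inv i ls \<longleftrightarrow> path_labels i ls \<and>
    (\<forall>v p. awalk s p v \<longrightarrow> length p \<le> i \<longrightarrow> at_most (ls ! v) (Some (val p)))"

lemma at_most_refl: "at_most m m"
  by (simp add: at_most_def)

lemma at_most_trans: "at_most m m' \<Longrightarrow> at_most m' m'' \<Longrightarrow> at_most m m''"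
  unfolding at_most_def by (metis order_trans)

lemma wt_add: "wt \<alpha> \<beta> (fst l + a, snd l + b) = wt \<alpha> \<beta> l + (\<alpha> * a + \<beta> * b)"
  by (simp add: wt_def algebra_simps)

lemma wt_val_append:
  assumes "set q \<subseteq> {..<length es}"
  shows "wt \<alpha> \<beta> (val p) \<le> wt \<alpha> \<beta> (val (p @ q))"
proof -
  have "0 \<le> sum_list (map w1 q)" "0 \<le> sum_list (map w2 q)"
    by (intro sum_list_nonneg, use assms nonneg(1) in auto)
      (intro sum_list_nonneg, use assms nonneg(2) in auto)
  then show ?thesis
    using coeffs by (simp add: wt_def val_def algebra_simps)
qed

lemma awalk_snoc:
  assumes "awalk s p u" "e < length es" "tail G e = u"
  shows "awalk s (p @ [e]) (head G e)"
proof -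
  have "awalk u [e] (head G e)"
    using arc_implies_awalk[of e] assms arcs_eq by auto
  then show ?thesis
    using assms(1) awalk_appendI by blast
qed

lemma apath_snoc:
  assumes "apath s p u" "e < length es" "tail G e = u" "head G e \<notin> set (awalk_verts s p)"
  shows "apath s (p @ [e]) (head G e)"
proof -
  have walk: "awalk s p u"
    using assms by (simp add: apath_def)
  have "awalk_verts s (p @ [e]) = awalk_verts s p @ [head G e]"
  proof (cases p rule: rev_cases)
    case Nil
    then show ?thesis
      using walk assms by (simp add: awalk_Nil_iff)
  next
    case (snoc q f)
    then have "head G f = u"
      using walk by (auto simp: awalk_simps)
    then show ?thesis
      using snoc assms by (simp add: awalk_verts_conv)
  qed
  then show ?thesis
    using assms awalk_snoc[OF walk] by (simp add: apath_def)
qed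

text \<open>
  A strict improvement never closes a cycle: with nonnegative weights, the part of the path up to
  the repeated vertex would already have given a label that is at most as large.
\<close>

lemma improvement_is_apath:
  assumes inv: "round_inv i old" and p: "apath s p u" "length p \<le> i"
    and e: "e < length es" "tail G e = u"
    and new: "at_most new_v (old ! head G e)"
    and better: "\<And>l. new_v = Some l \<Longrightarrow> wt \<alpha> \<beta> (val (p @ [e])) < wt \<alpha> \<beta> l"
  shows "apath s (p @ [e]) (head G e)"
proof (rule apath_snoc[OF p(1) e], rule notI)
  assume "head G e \<in> set (awalk_verts s p)"
  then obtain xs ys where "awalk_verts s p = xs @ head G e # ys"
    by (meson split_list)
  moreover have walk: "awalk s p u"
    using p by (simp add: apath_def)
  ultimately obtain q r where q: "cas s q (head G e)" "p = q @ r"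
    using awalk_decomp_verts[of s p u xs "head G e" ys] unfolding awalk_def by metis
  then have "awalk s q (head G e)"
    using walk by (auto simp: awalk_def)
  then have "at_most (old ! head G e) (Some (val q))"
    using inv p(2) q(2) by (simp add: round_inv_def)
  with new have "at_most new_v (Some (val q))"
    by (rule at_most_trans)
  then obtain l where l: "new_v = Some l" "wt \<alpha> \<beta> l \<le> wt \<alpha> \<beta> (val q)"
    by (auto simp: at_most_def)
  have "wt \<alpha> \<beta> (val q) \<le> wt \<alpha> \<beta> (val (q @ r @ [e]))"
    using walk q(2) e arcs_eq by (intro wt_val_append) (auto simp: awalk_def)
  then show False
    using better[OF l(1)] l(2) q(2) by simp
qed

text \<open>Seven operations: two weights of three each, and a comparison.\<close>

lemma runs_improves:
  assumes "rat_bound (4 * S + 1) (fst l)" "rat_bound (4 * S + 1) (snd l)"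
    and "\<And>l'. m = Some l' \<Longrightarrow> rat_bound (4 * S + 1) (fst l') \<and> rat_bound (4 * S + 1) (snd l')"
  shows "runs (improves \<alpha> \<beta> l m)
    (\<lambda>r. r \<longleftrightarrow> (\<forall>l'. m = Some l' \<longrightarrow> wt \<alpha> \<beta> l < wt \<alpha> \<beta> l')) (7 * op_time M)"
proof (cases m)
  case None
  then show ?thesis
    using op_time_pos[of M] by (auto simp: improves_def intro!: runs_ret)
next
  case (Some l')
  have l': "rat_bound (4 * S + 1) (fst l')" "rat_bound (4 * S + 1) (snd l')"
    using assms(3) Some by auto
  have M: "2 * ((12 * S + 2) + (4 * S + 1)) + 1 \<le> M"
    by (simp add: compare_bits_def)
  show ?thesis
    unfolding improves_def Some option.case
    by (rule runs_bind[OF runs_weight[OF coeff_bits assms(1,2) M]],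
        rule runs_bind[OF runs_weight[OF coeff_bits l' M]],
        rule runs_mono[OF runs_rat_op[of M]])
      (auto intro: rat_bound_wt[OF coeff_bits _ _ M] assms(1,2) l')
qed

text \<open>Labels are read from \<open>old\<close> and written to \<open>new\<close>, so one round
  lengthens a path by at most one arc. Entries of \<open>new\<close> never get worse, which
  preserves the effect of the arcs relaxed earlier in the round.\<close>

lemma runs_relax:
  assumes inv: "round_inv i old" and e: "e < length es"
    and new: "path_labels (Suc i) new" "\<And>v. v < n \<Longrightarrow> at_most (new ! v) (old ! v)"
  shows "runs (relax \<alpha> \<beta> old (es ! e) new)
    (\<lambda>new'. path_labels (Suc i) new' \<and> (\<forall>v<n. at_most (new' ! v) (new ! v)) \<and>
      (\<forall>l. old ! tail G e = Some l \<longrightarrow>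
        at_most (new' ! head G e) (Some (fst l + w1 e, snd l + w2 e))))
    (relax_time S)"
proof -
  define u v where "u = tail G e" and "v = head G e"
  have uv: "u < n" "v < n"
    using e arcs_eq verts_eq tail_in_verts head_in_verts by (auto simp: u_def v_def)
  have len: "length old = n" "length new = n"
    using inv new by (auto simp: round_inv_def path_labels_def)
  have lookup_old: "runs (lookup old u) (\<lambda>y. y = old ! u) n"
    and lookup_new: "runs (lookup new v) (\<lambda>y. y = new ! v) n"
    using runs_lookup[of u old] runs_lookup[of v new] uv len by auto
  have eq: "es ! e = (u, v, w1 e, w2 e)"
    using es_nth[OF e] by (simp add: u_def v_def)
  show ?thesis
  proof (cases "old ! u")
    case None
    have "runs (relax \<alpha> \<beta> old (es ! e) new) (\<lambda>new'. new' = new) (relax_time S)"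
      unfolding relax_def eq case_prod_conv
      using n_le
      by (intro runs_bind[OF lookup_old, where t' = 1])
        (auto simp: None relax_time_def intro: runs_ret)
    then show ?thesis
      by (rule runs_mono) (use None new at_most_refl in \<open>auto simp: u_def\<close>)
  next
    case (Some l)
    obtain p where p: "apath s p u" "length p \<le> i" "l = val p"
      using inv Some uv unfolding round_inv_def path_labels_def by blast
    have l: "rat_bound (3 * S) (fst l)" "rat_bound (3 * S) (snd l)"
      using labels_bounds[of l s u] p by (auto simp: labels_def)
    define l' where "l' = (fst l + w1 e, snd l + w2 e)"
    have l'_val: "l' = val (p @ [e])"
      by (simp add: l'_def val_snoc p)
    \<comment> \<open>The candidate is not yet known to belong to a simple path: it has the
      \<open>3 * S\<close> bits of \<open>l\<close> and those of one addition. If it wins,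
      \<open>improvement_is_apath\<close> brings the bound back to \<open>3 * S\<close>.\<close>
    have l': "rat_bound (4 * S + 1) (fst l')" "rat_bound (4 * S + 1) (snd l')"
      unfolding l'_def fst_conv snd_conv
      by (rule rat_bound_mono[OF rat_bound_add[OF l(1) bits(1)[OF e]]], simp)
        (rule rat_bound_mono[OF rat_bound_add[OF l(2) bits(2)[OF e]]], simp)
    have op1: "runs (rat_op (+) (fst l) (w1 e)) (\<lambda>z. z = fst l') (op_time M)"
      unfolding l'_def fst_conv
      by (rule runs_rat_op) (use l bits[OF e] in \<open>auto elim!: rat_bound_mono simp: compare_bits_def\<close>)
    have op2: "runs (rat_op (+) (snd l) (w2 e)) (\<lambda>z. z = snd l') (op_time M)"
      unfolding l'_def snd_conv
      by (rule runs_rat_op) (use l bits[OF e] in \<open>auto elim!: rat_bound_mono simp: compare_bits_def\<close>)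
    have imp: "runs (improves \<alpha> \<beta> l' (new ! v))
      (\<lambda>r. r \<longleftrightarrow> (\<forall>l''. new ! v = Some l'' \<longrightarrow> wt \<alpha> \<beta> l' < wt \<alpha> \<beta> l'')) (7 * op_time M)"
    proof (rule runs_improves[OF l'])
      fix l'' assume "new ! v = Some l''"
      then obtain q where "apath s q v" "l'' = val q"
        using new(1) uv unfolding path_labels_def by blast
      then show "rat_bound (4 * S + 1) (fst l'') \<and> rat_bound (4 * S + 1) (snd l'')"
        using labels_bounds(4,8)[of l'' s v] rat_bound_mono[of "3 * S" _ "4 * S + 1"]
        by (auto simp: labels_def)
    qed
    define better where "better \<longleftrightarrow> (\<forall>l''. new ! v = Some l'' \<longrightarrow> wt \<alpha> \<beta> l' < wt \<alpha> \<beta> l'')"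
    have "runs (relax \<alpha> \<beta> old (es ! e) new)
      (\<lambda>new'. new' = (if better then new[v := Some l'] else new)) (relax_time S)"
      unfolding relax_def eq case_prod_conv
    proof (rule runs_bind[OF lookup_old])
      fix lu assume lu: "lu = old ! u"
      have "runs (do {
         x \<leftarrow> rat_op (+) (fst l) (w1 e);
         y \<leftarrow> rat_op (+) (snd l) (w2 e);
         lv \<leftarrow> lookup new v;
         better \<leftarrow> improves \<alpha> \<beta> (x, y) lv;
         if better then update new v (Some (x, y)) else ret new })
        (\<lambda>new'. new' = (if better then new[v := Some l'] else new))
        (op_time M + (op_time M + (n + (7 * op_time M + Suc n))))"
        by (rule runs_bind[OF op1 _ order_refl], rule runs_bind[OF op2 _ order_refl],
            rule runs_bind[OF lookup_new _ order_refl], rule runs_bind[OF _ _ order_refl],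
            use imp in simp)
          (use runs_update[of new v "Some l'"] in \<open>auto simp: len better_def intro: runs_ret\<close>)
      then show "runs (case lu of
         None \<Rightarrow> ret new
       | Some l \<Rightarrow> do {
           x \<leftarrow> rat_op (+) (fst l) (w1 e);
           y \<leftarrow> rat_op (+) (snd l) (w2 e);
           lv \<leftarrow> lookup new v;
           better \<leftarrow> improves \<alpha> \<beta> (x, y) lv;
           if better then update new v (Some (x, y)) else ret new })
        (\<lambda>new'. new' = (if better then new[v := Some l'] else new)) (2 * n + 1 + 9 * op_time M)"
        unfolding lu Some option.case by (rule runs_mono) auto
    qed (use n_le in \<open>simp add: relax_time_def\<close>)
    then show ?thesis
    proof (rule runs_mono)
      fix new' assume new': "new' = (if better then new[v := Some l'] else new)"
      have "path_labels (Suc i) new'"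
      proof (cases better)
        case True
        have "apath s (p @ [e]) (head G e)"
          using inv p(1,2) e
        proof (rule improvement_is_apath)
          show "tail G e = u"
            by (simp add: u_def)
          show "at_most (new ! v) (old ! head G e)"
            using new(2) uv by (simp add: v_def)
          show "wt \<alpha> \<beta> (val (p @ [e])) < wt \<alpha> \<beta> k" if "new ! v = Some k" for k
            using True that by (simp add: better_def l'_val)
        qed
        moreover have "length (p @ [e]) \<le> Suc i"
          using p(2) by simp
        ultimately have l'_path: "\<exists>q. apath s q v \<and> length q \<le> Suc i \<and> l' = val q"
          unfolding v_def l'_val by blast
        show ?thesis
          using new(1) True l'_path uv
          by (auto simp: path_labels_def new' len nth_list_update)
      next
        case False
        then show ?thesis
          using new(1) by (simp add: new')
      qed
      moreover have "at_most (new' ! x) (new ! x)" if "x < n" for x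
        using that uv len by (force simp: new' at_most_def nth_list_update better_def)
      moreover have "at_most (new' ! v) (Some l')"
        using uv len by (auto simp: new' at_most_def better_def not_less)
      ultimately show "path_labels (Suc i) new' \<and> (\<forall>v<n. at_most (new' ! v) (new ! v)) \<and>
        (\<forall>l. old ! tail G e = Some l \<longrightarrow>
          at_most (new' ! head G e) (Some (fst l + w1 e, snd l + w2 e)))"
        using Some by (simp add: u_def v_def l'_def)
    qed simp
  qed
qed

lemma runs_relax_all:
  assumes inv: "round_inv i old" and xs: "set xs \<subseteq> {..<length es}"
    and new: "path_labels (Suc i) new" "\<And>v. v < n \<Longrightarrow> at_most (new ! v) (old ! v)"
  shows "runs (relax_all \<alpha> \<beta> old (map ((!) es) xs) new)
    (\<lambda>new'. path_labels (Suc i) new' \<and> (\<forall>v<n. at_most (new' ! v) (new ! v)) \<and>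
      (\<forall>e \<in> set xs. \<forall>l. old ! tail G e = Some l \<longrightarrow>
        at_most (new' ! head G e) (Some (fst l + w1 e, snd l + w2 e))))
    (length xs * relax_time S + 1)"
  using xs new
proof (induction xs arbitrary: new)
  case Nil
  then show ?case
    by (auto intro!: runs_ret at_most_refl)
next
  case (Cons e xs)
  have e: "e < length es"
    using Cons.prems by simp
  show ?case
    unfolding list.map relax_all.simps
  proof (rule runs_bind[OF runs_relax[OF inv e Cons.prems(2,3)]])
    fix new1
    assume new1: "path_labels (Suc i) new1 \<and> (\<forall>v<n. at_most (new1 ! v) (new ! v)) \<and>
      (\<forall>l. old ! tail G e = Some l \<longrightarrow>
        at_most (new1 ! head G e) (Some (fst l + w1 e, snd l + w2 e)))"
    have hd: "head G e < n"
      using e arcs_eq verts_eq head_in_verts by auto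
    show "runs (relax_all \<alpha> \<beta> old (map ((!) es) xs) new1)
      (\<lambda>new'. path_labels (Suc i) new' \<and> (\<forall>v<n. at_most (new' ! v) (new ! v)) \<and>
        (\<forall>e \<in> set (e # xs). \<forall>l. old ! tail G e = Some l \<longrightarrow>
          at_most (new' ! head G e) (Some (fst l + w1 e, snd l + w2 e))))
      (length xs * relax_time S + 1)"
    proof (rule runs_mono[OF Cons.IH])
      show "set xs \<subseteq> {..<length es}" "path_labels (Suc i) new1"
        using Cons.prems new1 by auto
      show "at_most (new1 ! v) (old ! v)" if "v < n" for v
        using at_most_trans[OF _ Cons.prems(3)[OF that]] new1 that by blast
    next
      fix new' assume *: "path_labels (Suc i) new' \<and> (\<forall>v<n. at_most (new' ! v) (new1 ! v)) \<and>
        (\<forall>e \<in> set xs. \<forall>l. old ! tail G e = Some l \<longrightarrow>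
          at_most (new' ! head G e) (Some (fst l + w1 e, snd l + w2 e)))"
      have "at_most (new' ! v) (new ! v)" if "v < n" for v
        using at_most_trans[of "new' ! v" "new1 ! v"] that * new1 by blast
      moreover have "at_most (new' ! head G e) (Some (fst l + w1 e, snd l + w2 e))"
        if "old ! tail G e = Some l" for l
        using at_most_trans[of "new' ! head G e" "new1 ! head G e"] that * new1 hd by blast
      ultimately show "path_labels (Suc i) new' \<and> (\<forall>v<n. at_most (new' ! v) (new ! v)) \<and>
        (\<forall>e \<in> set (e # xs). \<forall>l. old ! tail G e = Some l \<longrightarrow>
          at_most (new' ! head G e) (Some (fst l + w1 e, snd l + w2 e)))"
        using * unfolding set_simps by blast
    qed simp
  qed simp_all
qed

lemma runs_round:
  assumes inv: "round_inv i old"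
  shows "runs (relax_all \<alpha> \<beta> old es old) (round_inv (Suc i)) (S * relax_time S + 1)"
proof -
  have es: "map ((!) es) [0..<length es] = es"
    by (rule map_nth)
  have path: "path_labels (Suc i) old"
    using inv by (fastforce simp: round_inv_def path_labels_def)
  have "runs (relax_all \<alpha> \<beta> old (map ((!) es) [0..<length es]) old)
    (round_inv (Suc i)) (length [0..<length es] * relax_time S + 1)"
  proof (rule runs_mono[OF runs_relax_all[OF inv _ path]])
    fix new' assume *: "path_labels (Suc i) new' \<and> (\<forall>v<n. at_most (new' ! v) (old ! v)) \<and>
      (\<forall>e \<in> set [0..<length es]. \<forall>l. old ! tail G e = Some l \<longrightarrow>
        at_most (new' ! head G e) (Some (fst l + w1 e, snd l + w2 e)))"
    have "at_most (new' ! v) (Some (val p))" if p: "awalk s p v" "length p \<le> Suc i" for p v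
    proof (cases "length p \<le> i")
      case True
      have "v < n"
        using p verts_eq awalk_last_in_verts by auto
      moreover have "at_most (old ! v) (Some (val p))"
        using inv p True by (simp add: round_inv_def)
      ultimately show ?thesis
        using at_most_trans[of "new' ! v" "old ! v"] * by blast
    next
      case False
      \<comment> \<open>A walk of exactly \<open>Suc i\<close> arcs: the old label dominates its
        prefix, and relaxing the last arc carries the comparison over.\<close>
      then obtain q e where q: "p = q @ [e]" "length q \<le> i"
        using p(2) by (cases p rule: rev_cases) auto
      then have split: "awalk s q (awlast s q)" "awalk (awlast s q) [e] v"
        using p(1) awalk_append_iff[of s q "[e]" v] by simp_all
      then have e: "e < length es" "v = head G e" "tail G e = awlast s q"
        using arcs_eq by (auto simp: awalk_Cons_iff awalk_Nil_iff)
      then have walk: "awalk s q (tail G e)"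
        using split(1) by simp
      then have "at_most (old ! tail G e) (Some (val q))"
        using inv q by (simp add: round_inv_def)
      then obtain l where l: "old ! tail G e = Some l" "wt \<alpha> \<beta> l \<le> wt \<alpha> \<beta> (val q)"
        by (auto simp: at_most_def)
      have "at_most (new' ! v) (Some (fst l + w1 e, snd l + w2 e))"
        using * e l by auto
      moreover have "wt \<alpha> \<beta> (fst l + w1 e, snd l + w2 e) \<le> wt \<alpha> \<beta> (val p)"
        using l(2) by (simp add: q val_snoc wt_add)
      then have "at_most (Some (fst l + w1 e, snd l + w2 e)) (Some (val p))"
        by (simp add: at_most_def)
      ultimately show ?thesis
        by (rule at_most_trans)
    qed
    then show "round_inv (Suc i) new'"
      using * by (auto simp: round_inv_def)
  qed (auto intro: at_most_refl)
  then show ?thesis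
    unfolding es by (rule runs_mono) (use length_es_le in \<open>auto intro!: mult_right_mono\<close>)
qed

lemma runs_rounds:
  assumes "round_inv i ls"
  shows "runs (rounds \<alpha> \<beta> es m ls) (round_inv (i + m)) (m * (S * relax_time S + 1) + 1)"
  using assms
proof (induction m arbitrary: i ls)
  case 0
  then show ?case
    by (auto intro: runs_ret)
next
  case (Suc m)
  show ?case
    unfolding rounds.simps
  proof (rule runs_bind[OF runs_round[OF Suc.prems]])
    show "runs (rounds \<alpha> \<beta> es m ls') (round_inv (i + Suc m)) (m * (S * relax_time S + 1) + 1)"
      if "round_inv (Suc i) ls'" for ls'
      using Suc.IH[OF that] by simp
  qed simp
qed

lemma round_inv_0: "round_inv 0 ((replicate n None)[s := Some (0, 0)])"
  using s verts_eq
  by (auto simp: round_inv_def path_labels_def at_most_def nth_list_update val_def awalk_Nil_iff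
      apath_Nil_iff)

text \<open>Only simple paths have to be beaten, and they have at most \<open>n\<close> arcs, hence
  \<open>n\<close> rounds. Any label in \<open>labels s t\<close> forces an entry at
  \<open>t\<close>, since \<open>None\<close> is at most no label.\<close>

lemma runs_bellman_ford:
  assumes t: "t < n" and ne: "labels s t \<noteq> {}"
  shows "runs (bellman_ford n es \<alpha> \<beta> s t)
    (\<lambda>r. \<exists>l \<in> labels s t. r = Some l \<and> (\<forall>l' \<in> labels s t. wt \<alpha> \<beta> l \<le> wt \<alpha> \<beta> l')) (bf_time S)"
  unfolding bellman_ford_def
proof (rule runs_bind[OF runs_copies])
  fix ls0 assume ls0: "ls0 = replicate n (None :: label option)"
  have upd: "runs (update ls0 s (Some (0, 0))) (\<lambda>ls. ls = ls0[s := Some (0, 0)]) (Suc n)"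
    using runs_update[of ls0 s "Some (0, 0)"] by (simp add: ls0)
  have "runs (rounds \<alpha> \<beta> es n (ls0[s := Some (0, 0)])) (round_inv n) (n * (S * relax_time S + 1) + 1)"
    using runs_rounds[OF round_inv_0, of n] by (simp add: ls0)
  moreover have "runs (lookup ls t)
    (\<lambda>r. \<exists>l \<in> labels s t. r = Some l \<and> (\<forall>l' \<in> labels s t. wt \<alpha> \<beta> l \<le> wt \<alpha> \<beta> l')) n"
    if ls: "round_inv n ls" for ls
  proof (rule runs_mono)
    show "runs (lookup ls t) (\<lambda>r. r = ls ! t) n"
      using runs_lookup[of t ls] t ls by (simp add: round_inv_def path_labels_def)
    have dom: "at_most (ls ! t) (Some l')" if "l' \<in> labels s t" for l'
    proof -
      obtain p where p: "apath s p t" "l' = val p"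
        using \<open>l' \<in> labels s t\<close> by (auto simp: labels_def)
      then show ?thesis
        using ls length_apath[OF p(1)] verts_eq by (simp add: round_inv_def apath_def)
    qed
    obtain l where l: "ls ! t = Some l"
      using ne dom unfolding at_most_def by blast
    moreover have "l \<in> labels s t"
      using ls l t unfolding round_inv_def path_labels_def labels_def by blast
    ultimately show "\<exists>l \<in> labels s t. r = Some l \<and> (\<forall>l' \<in> labels s t. wt \<alpha> \<beta> l \<le> wt \<alpha> \<beta> l')"
      if "r = ls ! t" for r
      using that dom unfolding at_most_def by (metis option.inject)
  qed simp
  ultimately have "runs (rounds \<alpha> \<beta> es n (ls0[s := Some (0, 0)]) \<bind> (\<lambda>ls. lookup ls t))
    (\<lambda>r. \<exists>l \<in> labels s t. r = Some l \<and> (\<forall>l' \<in> labels s t. wt \<alpha> \<beta> l \<le> wt \<alpha> \<beta> l'))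
    (n * (S * relax_time S + 1) + 1 + n)"
    by (rule runs_bind) simp_all
  then show "runs (update ls0 s (Some (0, 0)) \<bind> (\<lambda>ls1. rounds \<alpha> \<beta> es n ls1 \<bind> (\<lambda>ls. lookup ls t)))
    (\<lambda>r. \<exists>l \<in> labels s t. r = Some l \<and> (\<forall>l' \<in> labels s t. wt \<alpha> \<beta> l \<le> wt \<alpha> \<beta> l'))
    (Suc n + (n * (S * relax_time S + 1) + 1 + n))"
    by (intro runs_bind[OF upd]) auto
next
  have "n * (S * relax_time S + 1) \<le> S * (S * relax_time S + 1)"
    using n_le by (rule mult_right_mono) simp
  then show "Suc n + (Suc n + (n * (S * relax_time S + 1) + 1 + n)) \<le> bf_time S"
    using n_le by (simp add: bf_time_def)
qed

end

end

section \<open>LARAC\<close>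

text \<open>The orientation determinant, twice the signed area of the triangle \<open>u p q\<close>:
  nonnegative iff \<open>q\<close> is not to the right of the line directed from \<open>u\<close> to
  \<open>p\<close>.\<close>

definition cross :: "label \<Rightarrow> label \<Rightarrow> label \<Rightarrow> rat" where
  "cross u p q = (fst p - fst u) * (snd q - snd u) - (snd p - snd u) * (fst q - fst u)"

text \<open>
  Invariant of LARAC: \<open>T\<close> is the intersection of a supporting line of the label set at \<open>c\<close> with one
  at \<open>d\<close>, so all labels below the chord \<open>c d\<close> lie in the triangle \<open>c T d\<close>, of area
  \<open>cross c T d / 2\<close>.
\<close>

definition larac_inv :: "label set \<Rightarrow> rat \<Rightarrow> label \<Rightarrow> label \<Rightarrow> label \<Rightarrow> bool" where
  "larac_inv P b c d T \<longleftrightarrow> c \<in> P \<and> d \<in> P \<and> snd d \<le> b \<and> b < snd c \<and>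
    (\<forall>p \<in> P. snd p \<le> b \<longrightarrow> fst c < fst p) \<and>
    (\<forall>p \<in> P. 0 \<le> cross c T p) \<and> (\<forall>p \<in> P. 0 \<le> cross T d p)"

text \<open>A point \<open>r\<close> splits the triangle \<open>c T d\<close> into three.\<close>

lemma cross_sum: "cross c T r + cross T d r + cross c r d = cross c T d"
  unfolding cross_def by (simp add: algebra_simps)

text \<open>\<open>h * (\<Delta> - h)\<close> is largest at \<open>h = \<Delta> / 2\<close>; this is
  the origin of the factor 4 per iteration.\<close>

lemma quarter_bound:
  fixes a h \<Delta> :: rat
  assumes "0 < h" "h \<le> \<Delta>" "a \<le> \<Delta> - h"
  shows "4 * (h / \<Delta> * a) \<le> \<Delta>"
proof -
  have "h * a \<le> h * (\<Delta> - h)"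
    using assms by (intro mult_left_mono) auto
  moreover have "0 \<le> (\<Delta> - 2 * h)\<^sup>2"
    by simp
  ultimately have "4 * (h * a) \<le> \<Delta> * \<Delta>"
    by (simp add: power2_eq_square algebra_simps)
  then show ?thesis
    using assms by (simp add: field_simps)
qed

text \<open>Barycentric coordinates of \<open>r\<close> in the triangle \<open>c T d\<close>, with
  denominators cleared: \<open>T\<close> has weight \<open>cross c r d / cross c T d\<close> and
  \<open>d\<close> has weight \<open>cross c T r / cross c T d\<close>.\<close>

lemma cross_barycentric_c:
  "cross c T d * (fst r - fst c) - cross c r d * (fst T - fst c) = cross c T r * (fst d - fst c)"
  "cross c T d * (snd r - snd c) - cross c r d * (snd T - snd c) = cross c T r * (snd d - snd c)"
  unfolding cross_def by algebra+

lemma cross_barycentric_d: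
  "cross c T d * (fst d - fst r) - cross c r d * (fst d - fst T) = cross T d r * (fst d - fst c)"
  "cross c T d * (snd d - snd r) - cross c r d * (snd d - snd T) = cross T d r * (snd d - snd c)"
  unfolding cross_def by algebra+

lemma cancel_scale:
  fixes x y z :: rat
  assumes "\<Delta> * \<tau> = h" "\<Delta> * \<kappa> = a" "\<Delta> * x - h * y = a * z" "\<Delta> \<noteq> 0"
  shows "x - \<tau> * y = \<kappa> * z"
proof -
  have "\<Delta> * (x - \<tau> * y) = \<Delta> * (\<kappa> * z)"
    using assms(3) by (simp add: right_diff_distrib mult.assoc flip: assms(1,2))
  then show ?thesis
    using assms(4) by simp
qed

text \<open>
  The supporting line at the new label \<open>r\<close> is parallel to the chord and cuts off a triangle on either
  side of \<open>r\<close>, each of at most a quarter of the old area.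
\<close>

lemma larac_inv_replace_d:
  assumes inv: "larac_inv P b c d T" and r: "r \<in> P" "snd r \<le> b" "0 < cross c r d"
    and min: "\<And>p. p \<in> P \<Longrightarrow> cross c p d \<le> cross c r d"
  obtains T' where "larac_inv P b c r T'" "4 * cross c T' r \<le> cross c T d"
proof -
  define \<Delta> h a where "\<Delta> = cross c T d" and "h = cross c r d" and "a = cross c T r"
  have sides: "0 \<le> a" "0 \<le> cross T d r"
    using inv r by (auto simp: larac_inv_def a_def)
  have sum: "a + cross T d r + h = \<Delta>"
    using cross_sum by (simp add: \<Delta>_def h_def a_def)
  then have pos: "0 < h" "h \<le> \<Delta>" "0 < \<Delta>"
    using sides r by (auto simp: h_def)
  define \<tau> \<kappa> where "\<tau> = h / \<Delta>" and "\<kappa> = a / \<Delta>"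
  have "0 \<le> \<tau>" "0 \<le> \<kappa>" and scaled: "\<Delta> * \<tau> = h" "\<Delta> * \<kappa> = a"
    using pos sides by (auto simp: \<tau>_def \<kappa>_def)
  \<comment> \<open>The point where the side \<open>c T\<close> meets the parallel to the chord
    through \<open>r\<close>; \<tau> is the barycentric weight of \<open>T\<close>.\<close>
  define T' where "T' = (fst c + \<tau> * (fst T - fst c), snd c + \<tau> * (snd T - snd c))"
  have c_T': "cross c T' p = \<tau> * cross c T p" for p
    unfolding cross_def T'_def by (simp add: algebra_simps)
  have r_T': "fst r - fst T' = \<kappa> * (fst d - fst c)" "snd r - snd T' = \<kappa> * (snd d - snd c)"
    using cross_barycentric_c[of c T d r, folded \<Delta>_def h_def a_def, THEN cancel_scale[OF scaled]]
      pos by (auto simp: T'_def)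
  \<comment> \<open>Up to the factor \<kappa>, the position of \<open>p\<close> relative to the new
    line is the difference of the distances of \<open>r\<close> and \<open>p\<close> from the chord,
    so \<open>min\<close> makes the line a supporting one.\<close>
  have T'_r: "cross T' r p = \<kappa> * (cross c r d - cross c p d)" for p
  proof -
    have "cross T' r p = cross T' r p - cross T' r r"
      by (simp add: cross_def)
    also have "\<dots> = (fst r - fst T') * (snd p - snd r) - (snd r - snd T') * (fst p - fst r)"
      unfolding cross_def by algebra
    also have "\<dots> = \<kappa> * (cross c r d - cross c p d)"
      unfolding r_T' cross_def by algebra
    finally show ?thesis .
  qed
  show thesis
  proof (rule that)
    show "larac_inv P b c r T'"
      using inv r \<open>0 \<le> \<tau>\<close> \<open>0 \<le> \<kappa>\<close> min by (auto simp: larac_inv_def c_T' T'_r)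
    have "a \<le> \<Delta> - h"
      using sum sides by simp
    then show "4 * cross c T' r \<le> cross c T d"
      using quarter_bound[OF pos(1,2)] by (simp add: c_T' \<tau>_def flip: a_def \<Delta>_def)
  qed
qed

text \<open>The mirror image at the side \<open>T d\<close>. The invariant also keeps labels within
  the bound strictly to the right of the current \<open>c\<close>, which for the new one is the
  hypothesis \<open>right\<close>.\<close>

lemma larac_inv_replace_c:
  assumes inv: "larac_inv P b c d T" and r: "r \<in> P" "b < snd r" "0 < cross c r d"
    and right: "\<And>p. p \<in> P \<Longrightarrow> snd p \<le> b \<Longrightarrow> fst r < fst p"
    and min: "\<And>p. p \<in> P \<Longrightarrow> cross c p d \<le> cross c r d"
  obtains T' where "larac_inv P b r d T'" "4 * cross r T' d \<le> cross c T d"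
proof -
  define \<Delta> h a where "\<Delta> = cross c T d" and "h = cross c r d" and "a = cross T d r"
  have sides: "0 \<le> a" "0 \<le> cross c T r"
    using inv r by (auto simp: larac_inv_def a_def)
  have sum: "cross c T r + a + h = \<Delta>"
    using cross_sum by (simp add: \<Delta>_def h_def a_def)
  then have pos: "0 < h" "h \<le> \<Delta>" "0 < \<Delta>"
    using sides r by (auto simp: h_def)
  define \<tau> \<kappa> where "\<tau> = h / \<Delta>" and "\<kappa> = a / \<Delta>"
  have "0 \<le> \<tau>" "0 \<le> \<kappa>" and scaled: "\<Delta> * \<tau> = h" "\<Delta> * \<kappa> = a"
    using pos sides by (auto simp: \<tau>_def \<kappa>_def)
  define T' where "T' = (fst d + \<tau> * (fst T - fst d), snd d + \<tau> * (snd T - snd d))"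
  have T'_d: "cross T' d p = \<tau> * cross T d p" for p
    unfolding cross_def T'_def fst_conv snd_conv by algebra
  have r_T'_d: "cross r T' d = \<tau> * a"
    unfolding a_def cross_def T'_def fst_conv snd_conv by algebra
  have T'_r: "fst T' - fst r = \<kappa> * (fst d - fst c)" "snd T' - snd r = \<kappa> * (snd d - snd c)"
    using cross_barycentric_d[of c T d r, folded \<Delta>_def h_def a_def, THEN cancel_scale[OF scaled]]
      pos by (auto simp: T'_def algebra_simps)
  have r_T': "cross r T' p = \<kappa> * (cross c r d - cross c p d)" for p
    unfolding cross_def[of r] T'_r unfolding cross_def by algebra
  show thesis
  proof (rule that)
    show "larac_inv P b r d T'"
      using inv r right \<open>0 \<le> \<tau>\<close> \<open>0 \<le> \<kappa>\<close> min by (auto simp: larac_inv_def T'_d r_T')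
    have "a \<le> \<Delta> - h"
      using sum sides by simp
    then show "4 * cross r T' d \<le> cross c T d"
      using quarter_bound[OF pos(1,2)] by (simp add: r_T'_d \<tau>_def flip: \<Delta>_def)
  qed
qed

text \<open>\<mu> makes the chord a level line of the weight. Distance from the chord is then
  proportional to the weight saved, so a label of least weight is furthest from it.\<close>

lemma cross_eq_wt_diff:
  assumes "snd d < snd c"
  defines "\<mu> \<equiv> (fst d - fst c) / (snd c - snd d)"
  shows "cross c p d = (snd c - snd d) * (wt 1 \<mu> c - wt 1 \<mu> p)" and "wt 1 \<mu> d = wt 1 \<mu> c"
proof -
  have "(snd c - snd d) * \<mu> = fst d - fst c"
    using assms by simp
  then show "cross c p d = (snd c - snd d) * (wt 1 \<mu> c - wt 1 \<mu> p)" "wt 1 \<mu> d = wt 1 \<mu> c"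
    unfolding cross_def wt_def by algebra+
qed

text \<open>The rational form of the two witnesses in \<open>opt_multiplier_eqI\<close>.\<close>

definition critical :: "label set \<Rightarrow> rat \<Rightarrow> rat \<Rightarrow> bool" where
  "critical P b \<mu> \<longleftrightarrow> 0 < \<mu> \<and>
    (\<exists>c \<in> P. b < snd c \<and> (\<forall>p \<in> P. wt 1 \<mu> c \<le> wt 1 \<mu> p)) \<and>
    (\<exists>d \<in> P. snd d \<le> b \<and> (\<forall>p \<in> P. wt 1 \<mu> d \<le> wt 1 \<mu> p))"

text \<open>Eleven operations: three for the multiplier, six for two weights, the equality test and
  the comparison with the bound.\<close>

definition larac_step_time :: "nat \<Rightarrow> nat" where
  "larac_step_time S = bf_time S + 11 * op_time (compare_bits S) + 1"

definition larac_time :: "nat \<Rightarrow> nat" where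
  "larac_time S =
    2 * bf_time S + 2 * op_time (compare_bits S) + (3 * S + 2) * larac_step_time S + 1"

section \<open>LARAC on an encoded graph\<close>

context encoded_graph
begin

text \<open>\<open>cross\<close> is quadratic in the coordinates, hence the square of
  \<open>D\<close>.\<close>

lemma cross_labels:
  assumes "c \<in> labels s t" "r \<in> labels s t" "d \<in> labels s t"
  shows "(of_int D)\<^sup>2 * cross c r d \<in> \<int>"
proof -
  let ?D = "of_int D :: rat"
  have "?D\<^sup>2 * cross c r d =
    (?D * fst r - ?D * fst c) * (?D * snd d - ?D * snd c)
    - (?D * snd r - ?D * snd c) * (?D * fst d - ?D * fst c)"
    unfolding cross_def by algebra
  also have "\<dots> \<in> \<int>"
    using labels_bounds(3,7)[OF assms(1)] labels_bounds(3,7)[OF assms(2)]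
      labels_bounds(3,7)[OF assms(3)] by (intro Ints_diff Ints_mult[OF Ints_diff Ints_diff])
  finally show ?thesis .
qed

lemma label_bits:
  assumes "l \<in> labels s t"
  shows "rat_bound M (fst l)" "rat_bound M (snd l)"
    "rat_bound (4 * S + 1) (fst l)" "rat_bound (4 * S + 1) (snd l)"
  using labels_bounds(4,8)[OF assms] by (auto elim!: rat_bound_mono simp: compare_bits_def)

context
  fixes s t :: nat and b :: rat
  assumes s: "s < n" and t: "t < n" and b: "rat_bound S b"
begin

lemma b_bits: "rat_bound M b"
  using b by (rule rat_bound_mono) (simp add: compare_bits_def)

text \<open>\<open>T\<close> is a ghost variable and \<open>m\<close> bounds the remaining
  iterations. As \<open>T\<close> need not have denominator \<open>D\<close>, integrality is applied
  to the labels \<open>c\<close>, \<open>r\<close>, \<open>d\<close>, whose \<open>cross\<close> is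
  at most that of \<open>c T d\<close>; a strict improvement thus forces
  \<open>m \<noteq> 0\<close>. On a tie, \<open>c\<close> and \<open>d\<close> are the witnesses for
  \<open>critical\<close>.\<close>

lemma runs_larac_loop:
  assumes "larac_inv (labels s t) b c d T" and "(of_int D)\<^sup>2 * cross c T d < 4 ^ m"
  shows "runs (larac_loop n es s t b c d)
    (\<lambda>res. \<exists>\<mu>. res = Some \<mu> \<and> critical (labels s t) b \<mu> \<and> rat_bound (12 * S + 2) \<mu>)
    ((m + 1) * larac_step_time S)"
  using assms
proof (induction m arbitrary: c d T rule: less_induct)
  case (less m)
  let ?P = "labels s t"
  let ?post = "\<lambda>res. \<exists>\<mu>. res = Some \<mu> \<and> critical ?P b \<mu> \<and> rat_bound (12 * S + 2) \<mu>"
  note inv = less.prems(1)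
  have cd: "c \<in> ?P" "d \<in> ?P" "snd d \<le> b" "b < snd c" "fst c < fst d"
    using inv by (auto simp: larac_inv_def)
  define \<mu> where "\<mu> = (fst d - fst c) / (snd c - snd d)"
  have "0 < \<mu>"
    using cd by (simp add: \<mu>_def)
  have num: "rat_bound (6 * S + 1) (fst d - fst c)"
    by (rule rat_bound_mono[OF rat_bound_diff[OF labels_bounds(4)[OF cd(2)] labels_bounds(4)[OF cd(1)]]])
      simp
  have den: "rat_bound (6 * S + 1) (snd c - snd d)"
    by (rule rat_bound_mono[OF rat_bound_diff[OF labels_bounds(8)[OF cd(1)] labels_bounds(8)[OF cd(2)]]])
      simp
  \<comment> \<open>\<mu> is computed afresh from two labels, with \<open>2 * (6 * S + 1)\<close>
    bits, so its size does not grow with the iterations.\<close>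
  have \<mu>_bits: "rat_bound (12 * S + 2) \<mu>"
    unfolding \<mu>_def by (rule rat_bound_mono[OF rat_bound_divide[OF num den]]) simp
  have num_M: "rat_bound M (fst d - fst c)" and den_M: "rat_bound M (snd c - snd d)"
    using num den by (auto elim!: rat_bound_mono simp: compare_bits_def)
  have M: "2 * ((12 * S + 2) + (4 * S + 1)) + 1 \<le> M"
    by (simp add: compare_bits_def)
  note bits = label_bits[of _ s t]
  have lam_runs: "runs (rat_op (/) (fst d - fst c) (snd c - snd d)) (\<lambda>z. z = \<mu>) (op_time M)"
    unfolding \<mu>_def by (rule runs_rat_op[OF num_M den_M])
  have bf: "runs (bellman_ford n es 1 \<mu> s t)
    (\<lambda>r. \<exists>l \<in> ?P. r = Some l \<and> (\<forall>l' \<in> ?P. wt 1 \<mu> l \<le> wt 1 \<mu> l')) (bf_time S)"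
    using s t cd \<open>0 < \<mu>\<close> \<mu>_bits by (intro runs_bellman_ford) (auto intro: rat_bound_1)
  have weight: "runs (weight 1 \<mu> l) (\<lambda>w. w = wt 1 \<mu> l) (3 * op_time M)" "rat_bound M (wt 1 \<mu> l)"
    if "l \<in> ?P" for l
    using runs_weight[OF rat_bound_1 \<mu>_bits bits(3,4)[OF that] M]
      rat_bound_wt[OF rat_bound_1 \<mu>_bits bits(3,4)[OF that] M] by auto
  have continue: "runs (if wt 1 \<mu> r = wt 1 \<mu> c then ret (Some \<mu>)
      else do {
        ok \<leftarrow> rat_op (\<le>) (snd r) b;
        if ok then larac_loop n es s t b c r else larac_loop n es s t b r d })
      ?post (op_time M + 1 + m * larac_step_time S)"
    if r: "r \<in> ?P" and min: "\<And>p. p \<in> ?P \<Longrightarrow> wt 1 \<mu> r \<le> wt 1 \<mu> p" for r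
  proof (cases "wt 1 \<mu> r = wt 1 \<mu> c")
    case True
    have "critical ?P b \<mu>"
      unfolding critical_def
      using \<open>0 < \<mu>\<close> cd min True cross_eq_wt_diff(2)[of d c] by (auto simp: \<mu>_def)
    then show ?thesis
      using True \<mu>_bits by (auto intro!: runs_ret)
  next
    case False
    have cross: "cross c p d = (snd c - snd d) * (wt 1 \<mu> c - wt 1 \<mu> p)" for p
      using cross_eq_wt_diff(1)[of d c p] cd by (simp add: \<mu>_def)
    have pos: "0 < cross c r d"
      unfolding cross using False min[OF cd(1)] cd by simp
    have max: "cross c p d \<le> cross c r d" if "p \<in> ?P" for p
      unfolding cross using min[OF that] cd by (intro mult_left_mono) auto
    have area: "cross c r d \<le> cross c T d"
    proof -
      have "0 \<le> cross c T r" "0 \<le> cross T d r"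
        using inv r by (auto simp: larac_inv_def)
      then show ?thesis
        using cross_sum[of c T r d] by linarith
    qed
    have "1 \<le> (of_int D)\<^sup>2 * cross c r d"
    proof -
      obtain k where k: "(of_int D)\<^sup>2 * cross c r d = of_int k"
        using cross_labels[OF cd(1) r cd(2)] by (auto elim: Ints_cases)
      have "0 < (of_int D)\<^sup>2 * cross c r d"
        using pos D_pos by simp
      then show ?thesis
        unfolding k by simp
    qed
    moreover have "(of_int D)\<^sup>2 * cross c r d \<le> (of_int D)\<^sup>2 * cross c T d"
      using area by (intro mult_left_mono) auto
    ultimately have "1 \<le> (of_int D)\<^sup>2 * cross c T d"
      by linarith
    then have "m \<noteq> 0"
      using less.prems(2) by (intro notI) simp
    then obtain k where k: "m = Suc k"
      using not0_implies_Suc by blast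
    have next_runs: "runs (larac_loop n es s t b c' d') ?post (m * larac_step_time S)"
      if "larac_inv ?P b c' d' T'" "4 * cross c' T' d' \<le> cross c T d" for c' d' T'
    proof -
      have "(of_int D)\<^sup>2 * (4 * cross c' T' d') \<le> (of_int D)\<^sup>2 * cross c T d"
        using that(2) by (intro mult_left_mono) auto
      also have "\<dots> < 4 * 4 ^ k"
        using less.prems(2) by (simp add: k)
      finally have "(of_int D)\<^sup>2 * cross c' T' d' < 4 ^ k"
        by simp
      from less.IH[OF _ that(1) this] show ?thesis
        by (simp add: k)
    qed
    have "runs (if snd r \<le> b then larac_loop n es s t b c r else larac_loop n es s t b r d)
      ?post (m * larac_step_time S)"
    proof (cases "snd r \<le> b")
      case True
      obtain T' where "larac_inv ?P b c r T'" "4 * cross c T' r \<le> cross c T d"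
        using larac_inv_replace_d[OF inv r True pos max] by blast
      then show ?thesis
        using True next_runs by simp
    next
      case False
      \<comment> \<open>A label within the bound consumes less of the constrained resource than
        \<open>r\<close>; as \<open>r\<close> has least weight, it must consume more of the
        other.\<close>
      have "fst r < fst p" if p: "p \<in> ?P" "snd p \<le> b" for p
      proof -
        have "fst r + \<mu> * snd r \<le> fst p + \<mu> * snd p"
          using min[OF p(1)] by (simp add: wt_def)
        moreover have "\<mu> * snd p < \<mu> * snd r"
          using p False \<open>0 < \<mu>\<close> by simp
        ultimately show ?thesis
          by linarith
      qed
      then obtain T' where "larac_inv ?P b r d T'" "4 * cross r T' d \<le> cross c T d"
        using larac_inv_replace_c[OF inv r _ pos _ max] False by (metis not_le)
      then show ?thesis
        using False next_runs by simp
    qed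
    then have "runs (do {
        ok \<leftarrow> rat_op (\<le>) (snd r) b;
        if ok then larac_loop n es s t b c r else larac_loop n es s t b r d })
      ?post (op_time M + m * larac_step_time S)"
      by (intro runs_bind[OF runs_rat_op[OF bits(2)[OF r] b_bits]]) auto
    then show ?thesis
      using False by (auto elim: runs_mono)
  qed
  have after_bf: "runs (case res of
      None \<Rightarrow> ret None
    | Some r \<Rightarrow> do {
        wr \<leftarrow> weight 1 \<mu> r;
        wc \<leftarrow> weight 1 \<mu> c;
        stop \<leftarrow> rat_op (=) wr wc;
        if stop then ret (Some \<mu>)
        else do {
          ok \<leftarrow> rat_op (\<le>) (snd r) b;
          if ok then larac_loop n es s t b c r else larac_loop n es s t b r d } })
    ?post (8 * op_time M + 1 + m * larac_step_time S)"
    if res: "\<exists>l \<in> ?P. res = Some l \<and> (\<forall>l' \<in> ?P. wt 1 \<mu> l \<le> wt 1 \<mu> l')" for res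
  proof -
    obtain r where r: "r \<in> ?P" "res = Some r" "\<And>p. p \<in> ?P \<Longrightarrow> wt 1 \<mu> r \<le> wt 1 \<mu> p"
      using res by blast
    show ?thesis
      unfolding r(2) option.case
    proof (rule runs_bind[OF weight(1)[OF r(1)]])
      fix wr assume wr: "wr = wt 1 \<mu> r"
      show "runs (do {
          wc \<leftarrow> weight 1 \<mu> c;
          stop \<leftarrow> rat_op (=) wr wc;
          if stop then ret (Some \<mu>)
          else do {
            ok \<leftarrow> rat_op (\<le>) (snd r) b;
            if ok then larac_loop n es s t b c r else larac_loop n es s t b r d } })
        ?post (5 * op_time M + 1 + m * larac_step_time S)"
      proof (rule runs_bind[OF weight(1)[OF cd(1)]])
        fix wc assume wc: "wc = wt 1 \<mu> c"
        show "runs (do {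
            stop \<leftarrow> rat_op (=) wr wc;
            if stop then ret (Some \<mu>)
            else do {
              ok \<leftarrow> rat_op (\<le>) (snd r) b;
              if ok then larac_loop n es s t b c r else larac_loop n es s t b r d } })
          ?post (2 * op_time M + 1 + m * larac_step_time S)"
          unfolding wr wc
        proof (rule runs_bind[OF runs_rat_op[OF weight(2)[OF r(1)] weight(2)[OF cd(1)]]])
          show "runs (if stop then ret (Some \<mu>)
            else do {
              ok \<leftarrow> rat_op (\<le>) (snd r) b;
              if ok then larac_loop n es s t b c r else larac_loop n es s t b r d })
            ?post (op_time M + 1 + m * larac_step_time S)"
            if "stop = (wt 1 \<mu> r = wt 1 \<mu> c)" for stop
            unfolding that by (intro continue[OF r(1)] r(3))
        qed simp
      qed simp
    qed simp
  qed
  show ?case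
  proof (subst larac_loop.simps, rule runs_bind[OF runs_rat_op[OF bits(1)[OF cd(2)] bits(1)[OF cd(1)]]])
    fix num assume num: "num = fst d - fst c"
    have body: "runs (do {
        res \<leftarrow> bellman_ford n es 1 \<mu> s t;
        case res of
          None \<Rightarrow> ret None
        | Some r \<Rightarrow> do {
            wr \<leftarrow> weight 1 \<mu> r;
            wc \<leftarrow> weight 1 \<mu> c;
            stop \<leftarrow> rat_op (=) wr wc;
            if stop then ret (Some \<mu>)
            else do {
              ok \<leftarrow> rat_op (\<le>) (snd r) b;
              if ok then larac_loop n es s t b c r else larac_loop n es s t b r d } } })
      ?post (bf_time S + (8 * op_time M + 1 + m * larac_step_time S))"
      by (rule runs_bind[OF bf after_bf]) simp_all
    show "runs (do {
        den \<leftarrow> rat_op (-) (snd c) (snd d);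
        lam \<leftarrow> rat_op (/) num den;
        res \<leftarrow> bellman_ford n es 1 lam s t;
        case res of
          None \<Rightarrow> ret None
        | Some r \<Rightarrow> do {
            wr \<leftarrow> weight 1 lam r;
            wc \<leftarrow> weight 1 lam c;
            stop \<leftarrow> rat_op (=) wr wc;
            if stop then ret (Some lam)
            else do {
              ok \<leftarrow> rat_op (\<le>) (snd r) b;
              if ok then larac_loop n es s t b c r else larac_loop n es s t b r d } } })
      ?post (2 * op_time M + (bf_time S + (8 * op_time M + 1 + m * larac_step_time S)))"
    proof (rule runs_bind[OF runs_rat_op[OF bits(2)[OF cd(1)] bits(2)[OF cd(2)]]])
      fix den assume den: "den = snd c - snd d"
      show "runs (do {
          lam \<leftarrow> rat_op (/) num den;
          res \<leftarrow> bellman_ford n es 1 lam s t;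
          case res of
            None \<Rightarrow> ret None
          | Some r \<Rightarrow> do {
              wr \<leftarrow> weight 1 lam r;
              wc \<leftarrow> weight 1 lam c;
              stop \<leftarrow> rat_op (=) wr wc;
              if stop then ret (Some lam)
              else do {
                ok \<leftarrow> rat_op (\<le>) (snd r) b;
                if ok then larac_loop n es s t b c r else larac_loop n es s t b r d } } })
        ?post (op_time M + (bf_time S + (8 * op_time M + 1 + m * larac_step_time S)))"
        unfolding num den
      proof (rule runs_bind[OF lam_runs])
        fix lam assume lam: "lam = \<mu>"
        show "runs (do {
            res \<leftarrow> bellman_ford n es 1 lam s t;
            case res of
              None \<Rightarrow> ret None
            | Some r \<Rightarrow> do {
                wr \<leftarrow> weight 1 lam r;
                wc \<leftarrow> weight 1 lam c;
                stop \<leftarrow> rat_op (=) wr wc;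
                if stop then ret (Some lam)
                else do {
                  ok \<leftarrow> rat_op (\<le>) (snd r) b;
                  if ok then larac_loop n es s t b c r else larac_loop n es s t b r d } } })
          ?post (bf_time S + (8 * op_time M + 1 + m * larac_step_time S))"
          unfolding lam by (rule body)
      qed simp
    qed simp
  qed (simp add: larac_step_time_def)
qed

lemma runs_larac:
  assumes ne: "p0 \<in> labels s t" "snd p0 \<le> b"
    and out: "\<And>c. c \<in> labels s t \<Longrightarrow> (\<And>p. p \<in> labels s t \<Longrightarrow> fst c \<le> fst p) \<Longrightarrow> b < snd c"
  shows "runs (larac n es s t b)
    (\<lambda>res. \<exists>\<mu>. res = Some \<mu> \<and> critical (labels s t) b \<mu> \<and> rat_bound (12 * S + 2) \<mu>) (larac_time S)"
proof -
  let ?P = "labels s t"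
  let ?post = "\<lambda>res. \<exists>\<mu>. res = Some \<mu> \<and> critical ?P b \<mu> \<and> rat_bound (12 * S + 2) \<mu>"
  note bits = label_bits[of _ s t]
  have bf: "runs (bellman_ford n es \<alpha> \<beta> s t)
    (\<lambda>r. \<exists>l \<in> ?P. r = Some l \<and> (\<forall>l' \<in> ?P. wt \<alpha> \<beta> l \<le> wt \<alpha> \<beta> l')) (bf_time S)"
    if "(\<alpha>, \<beta>) \<in> {(1, 0), (0, 1)}" for \<alpha> \<beta>
    using s t ne that by (intro runs_bellman_ford) (auto intro: rat_bound_1 rat_bound_0)
  show ?thesis
    unfolding larac_def
  proof (rule runs_bind[OF bf])
    fix rc assume "\<exists>l \<in> ?P. rc = Some l \<and> (\<forall>l' \<in> ?P. wt 1 0 l \<le> wt 1 0 l')"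
    then obtain c where c: "c \<in> ?P" "rc = Some c" "\<And>p. p \<in> ?P \<Longrightarrow> fst c \<le> fst p"
      by (auto simp: wt_def)
    show "runs (bellman_ford n es 0 1 s t \<bind> (\<lambda>d. case (rc, d) of
        (Some pc, Some pd) \<Rightarrow> do {
          okc \<leftarrow> rat_op (\<le>) (snd pc) b;
          okd \<leftarrow> rat_op (\<le>) (snd pd) b;
          if okc then ret (Some 0)
          else if okd then larac_loop n es s t b pc pd
          else ret None }
      | _ \<Rightarrow> ret None)) ?post (bf_time S + 2 * op_time M + (3 * S + 2) * larac_step_time S + 1)"
    proof (rule runs_bind[OF bf])
      fix rd assume "\<exists>l \<in> ?P. rd = Some l \<and> (\<forall>l' \<in> ?P. wt 0 1 l \<le> wt 0 1 l')"
      then obtain d where d: "d \<in> ?P" "rd = Some d" "\<And>p. p \<in> ?P \<Longrightarrow> snd d \<le> snd p"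
        by (auto simp: wt_def)
      have c_out: "b < snd c"
        using out c by blast
      have d_in: "snd d \<le> b"
        using d(3)[OF ne(1)] ne(2) by simp
      \<comment> \<open>The corner of the first two supporting lines: the vertical one through
        \<open>c\<close>, which minimizes \<open>fst\<close>, and the horizontal one through
        \<open>d\<close>, which minimizes \<open>snd\<close>.\<close>
      define T where "T = (fst c, snd d)"
      have right: "fst c < fst p" if p: "p \<in> ?P" "snd p \<le> b" for p
      \<comment> \<open>Otherwise \<open>p\<close> would minimize \<open>fst\<close> as well, and
        \<open>out\<close> would place it outside the bound.\<close>
      proof (rule ccontr)
        assume "\<not> fst c < fst p"
        then have "fst p \<le> fst q" if "q \<in> ?P" for q
          using c(3)[OF that] by simp
        then show False
          using out[OF p(1)] p(2) by simp
      qed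
      have inv: "larac_inv ?P b c d T"
        unfolding larac_inv_def
      proof (intro conjI ballI impI)
        show "0 \<le> cross c T p" if "p \<in> ?P" for p
          using c(3)[OF that] c_out d_in by (simp add: cross_def T_def mult_nonpos_nonneg)
        show "0 \<le> cross T d p" if "p \<in> ?P" for p
          using d(3)[OF that] c(3)[OF d(1)] by (simp add: cross_def T_def)
      qed (use c d c_out d_in right in auto)
      \<comment> \<open>Both legs of the right triangle are at most \<open>2 ^ (2 * S)\<close>, and
        scaling adds a factor of at most \<open>(2 ^ S)\<^sup>2\<close>, together
        \<open>4 ^ (3 * S)\<close>. The loop lemma asks for a strict bound, whence
        \<open>m = 3 * S + 1\<close>.\<close>
      have "cross c T d = (snd c - snd d) * (fst d - fst c)"
        unfolding cross_def T_def fst_conv snd_conv by algebra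
      also have "\<dots> \<le> 2 ^ (2 * S) * 2 ^ (2 * S)"
      proof (rule mult_mono)
        show "snd c - snd d \<le> 2 ^ (2 * S)" "fst d - fst c \<le> 2 ^ (2 * S)"
          using labels_bounds(6)[OF c(1)] labels_bounds(5)[OF d(1)]
            labels_bounds(2)[OF d(1)] labels_bounds(1)[OF c(1)] by simp_all
      qed (use right[OF d(1) d_in] in auto)
      finally have area: "cross c T d \<le> 2 ^ (2 * S) * 2 ^ (2 * S)" .
      have "(of_int D)\<^sup>2 \<le> (of_int (2 ^ S) :: rat)\<^sup>2"
        using D_le D_pos by (intro power_mono) (simp_all only: of_int_le_iff of_int_0_le_iff)
      then have "(of_int D)\<^sup>2 \<le> ((2 ^ S)\<^sup>2 :: rat)"
        by simp
      then have "(of_int D)\<^sup>2 * cross c T d \<le> (2 ^ S)\<^sup>2 * (2 ^ (2 * S) * 2 ^ (2 * S))"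
        using area inv d(1) by (intro mult_mono) (auto simp: larac_inv_def)
      also have "\<dots> = 4 ^ (3 * S)"
      proof -
        have "(4 :: rat) ^ (3 * S) = (2\<^sup>2) ^ (3 * S)"
          by simp
        also have "\<dots> = 2 ^ (2 * (3 * S))"
          by (simp only: power_mult)
        also have "\<dots> = (2 ^ S)\<^sup>2 * (2 ^ (2 * S) * 2 ^ (2 * S))"
          by (simp add: power2_eq_square flip: power_add)
        finally show ?thesis
          by simp
      qed
      also have "\<dots> < 4 ^ (3 * S + 1)"
        by simp
      finally have "(of_int D)\<^sup>2 * cross c T d < 4 ^ (3 * S + 1)" .
      from runs_larac_loop[OF inv this]
      have loop: "runs (larac_loop n es s t b c d) ?post ((3 * S + 2) * larac_step_time S)"
        by simp
      have "runs (do {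
          okc \<leftarrow> rat_op (\<le>) (snd c) b;
          okd \<leftarrow> rat_op (\<le>) (snd d) b;
          if okc then ret (Some 0)
          else if okd then larac_loop n es s t b c d
          else ret None }) ?post (2 * op_time M + (3 * S + 2) * larac_step_time S)"
      proof (rule runs_bind[OF runs_rat_op[OF bits(2)[OF c(1)] b_bits]])
        fix okc assume okc: "okc = (snd c \<le> b)"
        show "runs (do {
            okd \<leftarrow> rat_op (\<le>) (snd d) b;
            if okc then ret (Some 0)
            else if okd then larac_loop n es s t b c d
            else ret None }) ?post (op_time M + (3 * S + 2) * larac_step_time S)"
        proof (rule runs_bind[OF runs_rat_op[OF bits(2)[OF d(1)] b_bits]])
          show "runs (if okc then ret (Some 0)
            else if okd then larac_loop n es s t b c d
            else ret None) ?post ((3 * S + 2) * larac_step_time S)"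
            if "okd = (snd d \<le> b)" for okd
            using okc that c_out d_in loop by simp
        qed simp
      qed simp
      then show "runs (case (rc, rd) of
          (Some pc, Some pd) \<Rightarrow> do {
            okc \<leftarrow> rat_op (\<le>) (snd pc) b;
            okd \<leftarrow> rat_op (\<le>) (snd pd) b;
            if okc then ret (Some 0)
            else if okd then larac_loop n es s t b pc pd
            else ret None }
        | _ \<Rightarrow> ret None) ?post (2 * op_time M + (3 * S + 2) * larac_step_time S)"
        by (simp only: c(2) d(2) prod.case option.case)
    qed simp_all
  qed (simp_all add: larac_time_def)
qed

end

end

section \<open>The program\<close>

lemma of_rat_sum_list: "of_rat (sum_list xs) = sum_list (map of_rat xs)"
  by (induction xs) (simp_all add: of_rat_add)

lemma opt_multiplier_eq_critical:
  assumes fin: "finite (demand_paths N k)"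
    and f: "\<And>p. cost f p = real_of_rat (fst (F p))" and g: "\<And>p. cost g p = real_of_rat (snd (F p))"
    and crit: "critical (F ` demand_paths N k) b \<mu>"
  shows "opt_multiplier N f g (real_of_rat b) k = real_of_rat \<mu>"
proof -
  let ?P = "demand_paths N k"
  have wt: "cost f p + real_of_rat \<mu> * cost g p = real_of_rat (wt 1 \<mu> (F p))" for p
    by (simp add: f g wt_def of_rat_add of_rat_mult)
  obtain c d where c: "c \<in> ?P" "b < snd (F c)" "\<And>p. p \<in> ?P \<Longrightarrow> wt 1 \<mu> (F c) \<le> wt 1 \<mu> (F p)"
    and d: "d \<in> ?P" "snd (F d) \<le> b" "\<And>p. p \<in> ?P \<Longrightarrow> wt 1 \<mu> (F d) \<le> wt 1 \<mu> (F p)"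
    and "0 < \<mu>"
    using crit by (auto simp: critical_def)
  show ?thesis
  proof (rule opt_multiplier_eqI[OF fin])
    show "minimal_at ?P (cost f) (cost g) (real_of_rat \<mu>) d"
      "minimal_at ?P (cost f) (cost g) (real_of_rat \<mu>) c"
      using c d by (auto simp: minimal_at_def wt of_rat_less_eq)
  qed (use c d \<open>0 < \<mu>\<close> in \<open>auto simp: g of_rat_less_eq of_rat_less\<close>)
qed

text \<open>Stated for arbitrary \<open>f\<close> and \<open>g\<close>, to serve
  \<open>lam_min\<close> and, with the resources exchanged, \<open>lam_max\<close>.\<close>

lemma (in encoded_graph) runs_larac_opt_multiplier:
  fixes N :: "(nat, nat, 'k) vmtr" and f g :: "nat \<Rightarrow> real"
  assumes G: "graph N = G"
    and fg: "\<And>i. f i = real_of_rat (w1 i)" "\<And>i. g i = real_of_rat (w2 i)"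
    and b: "rat_bound S b"
    and p0: "p0 \<in> demand_paths N k" "cost g p0 \<le> real_of_rat b"
    and out: "\<And>p. shortest_path N f k p \<Longrightarrow> real_of_rat b < cost g p"
  shows "runs (larac n es (source N k) (dest N k) b)
    (\<lambda>res. \<exists>\<mu>. res = Some \<mu> \<and> real_of_rat \<mu> = opt_multiplier N f g (real_of_rat b) k \<and>
      rat_bound (12 * S + 2) \<mu>) (larac_time S)"
proof -
  let ?s = "source N k" and ?t = "dest N k"
  have paths: "demand_paths N k = {p. apath ?s p ?t}"
    by (simp add: demand_paths_def G)
  then have lab: "labels ?s ?t = val ` demand_paths N k"
    by (simp add: labels_def)
  have "f = (\<lambda>i. real_of_rat (w1 i))" "g = (\<lambda>i. real_of_rat (w2 i))"
    using fg by auto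
  then have cost: "cost f p = real_of_rat (fst (val p))" "cost g p = real_of_rat (snd (val p))" for p
    by (simp_all add: cost_def val_def of_rat_sum_list o_def)
  have st: "?s < n" "?t < n"
    using p0 paths verts_eq awalk_hd_in_verts awalk_last_in_verts by (auto simp: apath_def)
  have fin: "finite (demand_paths N k)"
    unfolding paths by (rule apaths_finite)
  have "runs (larac n es ?s ?t b)
    (\<lambda>res. \<exists>\<mu>. res = Some \<mu> \<and> critical (labels ?s ?t) b \<mu> \<and> rat_bound (12 * S + 2) \<mu>)
    (larac_time S)"
  proof (rule runs_larac[OF st b])
    show "val p0 \<in> labels ?s ?t" "snd (val p0) \<le> b"
      using p0 by (auto simp: lab cost of_rat_less_eq)
    fix c assume c: "c \<in> labels ?s ?t" "\<And>p. p \<in> labels ?s ?t \<Longrightarrow> fst c \<le> fst p"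
    obtain p where p: "p \<in> demand_paths N k" "c = val p"
      using c(1) by (auto simp: lab)
    then have "shortest_path N f k p"
      using c(2) by (auto simp: shortest_path_def cost of_rat_less_eq lab)
    then show "b < snd c"
      using out[of p] by (simp add: cost of_rat_less p)
  qed
  then show ?thesis
    by (rule runs_mono) (use opt_multiplier_eq_critical[OF fin cost] in \<open>auto simp: lab\<close>)
qed

text \<open>The product of all denominators: their lengths add up, so the exponent stays within the
  input size.\<close>

lemma common_denominator:
  fixes es :: "arc list"
  obtains D where "0 < D" "D \<le> 2 ^ (\<Sum>(u, v, a, b) \<leftarrow> es. 1 + rat_bits a + rat_bits b)"
    "\<And>u v a b. (u, v, a, b) \<in> set es \<Longrightarrow> of_int D * a \<in> \<int>"
    "\<And>u v a b. (u, v, a, b) \<in> set es \<Longrightarrow> of_int D * b \<in> \<int>"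
proof -
  have "\<exists>D. 0 < D \<and> D \<le> 2 ^ (\<Sum>(u, v, a, b) \<leftarrow> es. 1 + rat_bits a + rat_bits b) \<and>
    (\<forall>(u, v, a, b) \<in> set es. of_int D * a \<in> \<int> \<and> of_int D * b \<in> \<int>)"
  proof (induction es)
    case Nil
    show ?case
      by (intro exI[of _ 1]) simp
  next
    case (Cons e es)
    obtain u v a b where e: "e = (u, v, a, b)"
      by (cases e)
    let ?B = "\<Sum>(u, v, a, b) \<leftarrow> es. 1 + rat_bits a + rat_bits b"
    obtain D where D: "0 < D" "D \<le> 2 ^ ?B"
      "\<forall>(u, v, a, b) \<in> set es. of_int D * a \<in> \<int> \<and> of_int D * b \<in> \<int>"
      using Cons.IH by blast
    let ?D = "denom a * denom b * D"
    have "denom a * denom b * D \<le> 2 ^ rat_bits a * 2 ^ rat_bits b * 2 ^ ?B"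
      using D denom_pos[of a] denom_pos[of b] denom_le[of a] denom_le[of b]
      by (intro mult_mono) (auto intro: less_imp_le)
    also have "\<dots> \<le> 2 ^ (1 + rat_bits a + rat_bits b + ?B)"
      by (simp add: power_add)
    finally have le: "?D \<le> 2 ^ (1 + rat_bits a + rat_bits b + ?B)" .
    have "of_int ?D * x \<in> \<int>" if "of_int D * x \<in> \<int>" for x :: rat
    proof -
      have "of_int ?D * x = of_int (denom a * denom b) * (of_int D * x)"
        by simp
      then show ?thesis
        using that by (metis Ints_mult Ints_of_int)
    qed
    moreover have "of_int ?D * a \<in> \<int>" "of_int ?D * b \<in> \<int>"
    proof -
      have "of_int ?D * a = of_int (denom b * D) * (of_int (denom a) * a)"
        "of_int ?D * b = of_int (denom a * D) * (of_int (denom b) * b)"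
        by simp_all
      then show "of_int ?D * a \<in> \<int>" "of_int ?D * b \<in> \<int>"
        unfolding denom_mult by (metis Ints_mult Ints_of_int)+
    qed
    ultimately show ?case
      using le D denom_pos[of a] denom_pos[of b] unfolding e
      by (intro exI[of _ ?D]) auto
  qed
  then show thesis
    using that by blast
qed

section \<open>Running times of the list programs\<close>

lemma runs_swap_resources:
  "runs (swap_resources es) (\<lambda>es'. es' = map (\<lambda>(u, v, a, b). (u, v, b, a)) es) (length es + 1)"
proof (induction es rule: swap_resources.induct)
  case (2 u v a b es)
  show ?case
    unfolding swap_resources.simps
    by (rule runs_bind[OF "2.IH", where t' = 1]) (auto intro: runs_ret)
qed (auto intro: runs_ret)

text \<open>The induction is over a list \<open>ks\<close> of positions in \<open>ds\<close>,
  because \<open>lo\<close> and \<open>hi\<close> depend on the index of a demand, which its list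
  entry does not contain.\<close>

lemma runs_preprocess:
  fixes lo hi :: "nat \<Rightarrow> real"
  assumes B: "1 \<le> B"
    and larac: "\<And>k s t b1 b2. k \<in> set ks \<Longrightarrow> ds ! k = (s, t, b1, b2) \<Longrightarrow>
      runs (larac n es s t b2) (\<lambda>res. \<exists>\<mu>. res = Some \<mu> \<and> real_of_rat \<mu> = lo k \<and> rat_bound B \<mu>) T \<and>
      runs (larac n es' s t b1)
        (\<lambda>res. \<exists>\<mu>. res = Some \<mu> \<and> 1 / real_of_rat \<mu> = hi k \<and> rat_bound B \<mu>) T"
  shows "runs (preprocess n es es' (map ((!) ds) ks))
    (\<lambda>js. real_interval ` set js = (\<lambda>k. (lo k, hi k)) ` {k \<in> set ks. lo k \<le> hi k} \<and>
      length js \<le> length ks \<and> (\<forall>j \<in> set js. rat_bound B (fst j) \<and> rat_bound B (snd j)))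
    (length ks * (2 * T + 2 * op_time B + 1) + 1)"
  using larac
proof (induction ks)
  case Nil
  show ?case
    by (auto intro: runs_ret)
next
  case (Cons k ks)
  let ?post = "\<lambda>ks js. real_interval ` set js = (\<lambda>k. (lo k, hi k)) ` {k \<in> set ks. lo k \<le> hi k} \<and>
    length js \<le> length ks \<and> (\<forall>j \<in> set js. rat_bound B (fst j) \<and> rat_bound B (snd j))"
  obtain s t b1 b2 where k: "ds ! k = (s, t, b1, b2)"
    by (cases "ds ! k")
  note l2 = Cons.prems[of k, OF _ k, THEN conjunct1, simplified]
  note l1 = Cons.prems[of k, OF _ k, THEN conjunct2, simplified]
  have IH: "runs (preprocess n es es' (map ((!) ds) ks)) (?post ks)
    (length ks * (2 * T + 2 * op_time B + 1) + 1)"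
    using Cons.prems by (intro Cons.IH) simp
  show ?case
    unfolding list.map k preprocess.simps
  proof (rule runs_bind[OF IH])
    fix js assume js: "?post ks js"
    show "runs (do {
        m2 \<leftarrow> larac n es s t b2;
        m1 \<leftarrow> larac n es' s t b1;
        case (m2, m1) of
          (Some l2, Some l1) \<Rightarrow> do {
            lmax \<leftarrow> rat_op (/) 1 l1;
            keep \<leftarrow> rat_op (\<le>) l2 lmax;
            ret (if keep then (l2, lmax) # js else js) }
        | _ \<Rightarrow> ret js }) (?post (k # ks)) (2 * T + 2 * op_time B + 1)"
    proof (rule runs_bind[OF l2])
      fix m2 assume m2: "\<exists>\<mu>. m2 = Some \<mu> \<and> real_of_rat \<mu> = lo k \<and> rat_bound B \<mu>"
      show "runs (do {
          m1 \<leftarrow> larac n es' s t b1;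
          case (m2, m1) of
            (Some l2, Some l1) \<Rightarrow> do {
              lmax \<leftarrow> rat_op (/) 1 l1;
              keep \<leftarrow> rat_op (\<le>) l2 lmax;
              ret (if keep then (l2, lmax) # js else js) }
          | _ \<Rightarrow> ret js }) (?post (k # ks)) (T + 2 * op_time B + 1)"
      proof (rule runs_bind[OF l1])
        fix m1 assume m1: "\<exists>\<mu>. m1 = Some \<mu> \<and> 1 / real_of_rat \<mu> = hi k \<and> rat_bound B \<mu>"
        obtain x where x: "m2 = Some x" "real_of_rat x = lo k" "rat_bound B x"
          using m2 by blast
        obtain y where y: "m1 = Some y" "1 / real_of_rat y = hi k" "rat_bound B y"
          using m1 by blast
        \<comment> \<open>Inversion exchanges numerator and denominator and costs no bits, as
          \<open>1\<close> is bounded with exponent 0.\<close>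
        have z: "real_of_rat (1 / y) = hi k" "rat_bound B (1 / y)"
          using y rat_bound_divide[OF rat_bound_1[of 0] y(3)] by (simp_all add: of_rat_divide)
        have keep: "x \<le> 1 / y \<longleftrightarrow> lo k \<le> hi k"
          by (simp only: of_rat_less_eq flip: x(2) z(1))
        have fin: "?post (k # ks) (if x \<le> 1 / y then (x, 1 / y) # js else js)"
        proof (cases "lo k \<le> hi k")
          case True
          then have "{i \<in> set (k # ks). lo i \<le> hi i} = insert k {i \<in> set ks. lo i \<le> hi i}"
            by auto
          then show ?thesis
            using True js x z keep by (simp add: real_interval_def)
        next
          case False
          then have "{i \<in> set (k # ks). lo i \<le> hi i} = {i \<in> set ks. lo i \<le> hi i}"
            by auto
          then show ?thesis
            using False js keep by auto
        qed
        have "runs (do {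
            lmax \<leftarrow> rat_op (/) 1 y;
            keep \<leftarrow> rat_op (\<le>) x lmax;
            ret (if keep then (x, lmax) # js else js) }) (?post (k # ks)) (2 * op_time B + 1)"
        proof (rule runs_bind[OF runs_rat_op[OF rat_bound_1 y(3)]])
          fix lmax assume lmax: "lmax = 1 / y"
          show "runs (do {
              keep \<leftarrow> rat_op (\<le>) x lmax;
              ret (if keep then (x, lmax) # js else js) }) (?post (k # ks)) (op_time B + 1)"
            unfolding lmax
          proof (rule runs_bind[OF runs_rat_op[OF x(3) z(2)]])
            show "runs (ret (if keep then (x, 1 / y) # js else js)) (?post (k # ks)) 1"
              if "keep = (x \<le> 1 / y)" for keep
              unfolding that using fin by (intro runs_ret) simp_all
          qed simp
        qed simp
        then show "runs (case (m2, m1) of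
            (Some l2, Some l1) \<Rightarrow> do {
              lmax \<leftarrow> rat_op (/) 1 l1;
              keep \<leftarrow> rat_op (\<le>) l2 lmax;
              ret (if keep then (l2, lmax) # js else js) }
          | _ \<Rightarrow> ret js) (?post (k # ks)) (2 * op_time B + 1)"
          by (simp only: x(1) y(1) prod.case option.case)
      qed simp
    qed simp
  qed simp
qed

lemma runs_insert_demand:
  assumes "rat_bound B (snd k)" "\<forall>j \<in> set js. rat_bound B (snd j)"
  shows "runs (insert_demand k js) (\<lambda>ks. ks = insort_key snd k js)
    ((length js + 1) * (op_time B + 1))"
  using assms(2)
proof (induction js)
  case Nil
  show ?case
    by (auto intro: runs_ret)
next
  case (Cons j js)
  have IH: "runs (insert_demand k js) (\<lambda>ks. ks = insort_key snd k js)
    ((length js + 1) * (op_time B + 1))"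
    using Cons by simp
  have j: "rat_bound B (snd j)"
    using Cons.prems by simp
  show ?case
    unfolding insert_demand.simps
  proof (rule runs_bind[OF runs_rat_op[OF assms(1) j]])
    fix le assume le: "le = (snd k \<le> snd j)"
    show "runs (if le then ret (k # j # js) else do { ks \<leftarrow> insert_demand k js; ret (j # ks) })
      (\<lambda>ks. ks = insort_key snd k (j # js)) ((length js + 1) * (op_time B + 1) + 1)"
    proof (cases le)
      case True
      then show ?thesis
        using le by (auto intro: runs_ret)
    next
      case False
      then show ?thesis
        using le by (auto intro!: runs_bind[OF IH, where t' = 1] runs_ret)
    qed
  qed simp
qed

lemma runs_sort_demands:
  assumes "\<forall>j \<in> set ks. rat_bound B (snd j)"
  shows "runs (sort_demands ks) (\<lambda>js. js = sort_key snd ks)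
    (length ks * (length ks * (op_time B + 1)) + 1)"
  using assms
proof (induction ks)
  case Nil
  show ?case
    by (auto intro: runs_ret)
next
  case (Cons k ks)
  have IH: "runs (sort_demands ks) (\<lambda>js. js = sort_key snd ks)
    (length ks * (length ks * (op_time B + 1)) + 1)"
    using Cons by simp
  show ?case
    unfolding sort_demands.simps
  proof (rule runs_bind[OF IH])
    fix js assume js: "js = sort_key snd ks"
    show "runs (insert_demand k js) (\<lambda>js. js = sort_key snd (k # ks))
      ((length ks + 1) * (op_time B + 1))"
      using runs_insert_demand[of B k js] Cons.prems by (simp add: js)
  qed (simp add: algebra_simps)
qed

lemma runs_drop_covered:
  assumes "rat_bound B l" "\<forall>j \<in> set ks. rat_bound B (fst j) \<and> rat_bound B (snd j)"
  shows "runs (drop_covered l ks) (\<lambda>js. js = filter (\<lambda>j. \<not> (fst j \<le> l \<and> l \<le> snd j)) ks)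
    (length ks * (2 * op_time B + 1) + 1)"
  using assms(2)
proof (induction ks)
  case Nil
  show ?case
    by (auto intro: runs_ret)
next
  case (Cons k ks)
  let ?f = "filter (\<lambda>j. \<not> (fst j \<le> l \<and> l \<le> snd j))"
  have IH: "runs (drop_covered l ks) (\<lambda>js. js = ?f ks) (length ks * (2 * op_time B + 1) + 1)"
    using Cons by simp
  have k: "rat_bound B (fst k)" "rat_bound B (snd k)"
    using Cons.prems by auto
  show ?case
    unfolding drop_covered.simps
  proof (rule runs_bind[OF IH])
    fix js assume js: "js = ?f ks"
    show "runs (do {
        lo \<leftarrow> rat_op (\<le>) (fst k) l;
        hi \<leftarrow> rat_op (\<le>) l (snd k);
        ret (if lo \<and> hi then js else k # js) }) (\<lambda>js. js = ?f (k # ks)) (2 * op_time B + 1)"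
    proof (rule runs_bind[OF runs_rat_op[OF k(1) assms(1)]])
      fix lo assume lo: "lo = (fst k \<le> l)"
      show "runs (do {
          hi \<leftarrow> rat_op (\<le>) l (snd k);
          ret (if lo \<and> hi then js else k # js) }) (\<lambda>js. js = ?f (k # ks)) (op_time B + 1)"
        by (rule runs_bind[OF runs_rat_op[OF assms(1) k(2)], where t' = 1])
          (auto intro!: runs_ret simp: lo js)
    qed simp
  qed simp
qed

text \<open>The program recurs exactly as \<open>greedy\<close> does. Each head costs one linear
  pass and the filtered list is no longer than the tail, which gives a quadratic number of
  operations.\<close>

lemma runs_greedy_loop:
  assumes "\<forall>j \<in> set ks. rat_bound B (fst j) \<and> rat_bound B (snd j)"
  shows "runs (greedy_loop ks) (\<lambda>ls. ls = greedy ks)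
    (length ks * (length ks * (2 * op_time B + 1) + 2) + 1)"
  using assms
proof (induction ks rule: greedy.induct)
  case 1
  show ?case
    by (subst greedy_loop.simps) (auto intro: runs_ret)
next
  case (2 k ks)
  define js where "js = filter (\<lambda>j. \<not> (fst j \<le> snd k \<and> snd k \<le> snd j)) ks"
  define C where "C = 2 * op_time B + 1"
  have len: "length js \<le> length ks"
    by (simp add: js_def)
  have drop: "runs (drop_covered (snd k) ks) (\<lambda>js'. js' = js) (length ks * C + 1)"
    unfolding C_def js_def using "2.prems" by (intro runs_drop_covered) simp_all
  have IH: "runs (greedy_loop js) (\<lambda>ls. ls = greedy js) (length js * (length js * C + 2) + 1)"
    unfolding C_def js_def using "2.prems" by (intro "2.IH") auto
  have IH': "runs (greedy_loop js) (\<lambda>ls. ls = greedy js) (length ks * (length ks * C + 2) + 1)"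
  proof (rule runs_mono[OF IH])
    show "length js * (length js * C + 2) + 1 \<le> length ks * (length ks * C + 2) + 1"
      using len by (intro add_mono mult_mono order_refl) auto
  qed
  have eq: "greedy (k # ks) = snd k # greedy js"
    by (simp add: js_def)
  show ?case
    unfolding C_def[symmetric]
  proof (subst greedy_loop.simps, unfold list.case, rule runs_bind[OF drop])
    show "runs (greedy_loop js' \<bind> (\<lambda>ls. ret (snd k # ls))) (\<lambda>ls. ls = greedy (k # ks))
      (length ks * (length ks * C + 2) + 2)" if "js' = js" for js'
      unfolding that
      by (rule runs_bind[OF IH', where t' = 1]) (auto intro!: runs_ret simp: eq simp del: greedy.simps)
    show "length ks * C + 1 + (length ks * (length ks * C + 2) + 2)
      \<le> length (k # ks) * (length (k # ks) * C + 2) + 1"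
      by (simp add: algebra_simps)
  qed
qed

section \<open>The polynomial time bound\<close>

definition program_time :: "nat \<Rightarrow> nat" where
  "program_time S = (S + 1)
    + (S * (2 * larac_time S + 2 * op_time (12 * S + 2) + 1) + 1)
    + (S * (S * (op_time (12 * S + 2) + 1)) + 1)
    + (S * (S * (2 * op_time (12 * S + 2) + 1) + 2) + 1)"

text \<open>Equality rather than domination: the time bounds are literally polynomial expressions,
  so closure under sums, products and powers suffices.\<close>

definition polynomial :: "(nat \<Rightarrow> nat) \<Rightarrow> bool" where
  "polynomial f \<longleftrightarrow> (\<exists>p. \<forall>n. f n = poly p n)"

lemma polynomial_const: "polynomial (\<lambda>n. c)"
  unfolding polynomial_def by (rule exI[of _ "[:c:]"]) simp

lemma polynomial_id: "polynomial (\<lambda>n. n)"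
  unfolding polynomial_def by (rule exI[of _ "[:0, 1:]"]) simp

lemma polynomial_add: "polynomial f \<Longrightarrow> polynomial g \<Longrightarrow> polynomial (\<lambda>n. f n + g n)"
  unfolding polynomial_def by (metis poly_add)

lemma polynomial_mult: "polynomial f \<Longrightarrow> polynomial g \<Longrightarrow> polynomial (\<lambda>n. f n * g n)"
  unfolding polynomial_def by (metis poly_mult)

lemma polynomial_power: "polynomial f \<Longrightarrow> polynomial (\<lambda>n. f n ^ k)"
  unfolding polynomial_def by (metis poly_power)

lemma polynomial_program_time: "polynomial program_time"
  unfolding program_time_def [abs_def] larac_time_def larac_step_time_def bf_time_def relax_time_def
    op_time_def compare_bits_def
  by (intro polynomial_add polynomial_mult polynomial_power polynomial_const polynomial_id)

text \<open>Both orders of the resources share the graph and \<open>D\<close>, since exchanging the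
  two weights of an arc changes neither its ends nor the denominators involved.\<close>

lemma encoded_graph_of_instance:
  assumes I: "vmtr_instance (instance_of I)"
  defines "es \<equiv> arc_list I"
  obtains D where "encoded_graph (graph (instance_of I)) (num_verts I) (input_size I) D
      (\<lambda>i. fst (snd (snd (es ! i)))) (\<lambda>i. snd (snd (snd (es ! i)))) es"
    and "encoded_graph (graph (instance_of I)) (num_verts I) (input_size I) D
      (\<lambda>i. snd (snd (snd (es ! i)))) (\<lambda>i. fst (snd (snd (es ! i))))
      (map (\<lambda>(u, v, a, b). (u, v, b, a)) es)"
proof -
  let ?w1 = "\<lambda>i. fst (snd (snd (es ! i)))" and ?w2 = "\<lambda>i. snd (snd (snd (es ! i)))"
  let ?S = "input_size I" and ?G = "graph (instance_of I)"
  let ?bits = "\<lambda>(u, v, a, b). 1 + rat_bits a + rat_bits b"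
  have G: "verts ?G = {..<num_verts I}" "arcs ?G = {..<length es}"
    "tail ?G i = fst (es ! i)" "head ?G i = fst (snd (es ! i))" for i
    by (simp_all add: instance_of_def es_def case_prod_beta)
  have nth: "es ! i = (fst (es ! i), fst (snd (es ! i)), ?w1 i, ?w2 i)" for i
    by simp
  have res: "res1 (instance_of I) i = of_rat (?w1 i)" "res2 (instance_of I) i = of_rat (?w2 i)" for i
    by (simp_all add: instance_of_def es_def case_prod_beta)
  have fin: "fin_digraph ?G"
    using I by (simp add: vmtr_instance_def)
  have nonneg: "0 \<le> ?w1 i" "0 \<le> ?w2 i" if "i < length es" for i
    using I that by (auto simp: vmtr_instance_def G(2) res)
  have sum_le: "(\<Sum>e \<leftarrow> es. ?bits e) \<le> ?S" and n_le: "num_verts I \<le> ?S"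
    by (simp_all add: input_size_def es_def)
  have "length es \<le> (\<Sum>e \<leftarrow> es. ?bits e)"
    by (induction es) auto
  then have len: "length es \<le> ?S"
    using sum_le by simp
  have bits: "rat_bound ?S (?w1 i)" "rat_bound ?S (?w2 i)" if "i < length es" for i
  proof -
    have "?bits (es ! i) \<le> (\<Sum>e \<leftarrow> es. ?bits e)"
      using that by (intro member_le_sum_list) auto
    then have "rat_bits (?w1 i) \<le> ?S" "rat_bits (?w2 i) \<le> ?S"
      using sum_le by (auto simp: case_prod_beta)
    then show "rat_bound ?S (?w1 i)" "rat_bound ?S (?w2 i)"
      using rat_bound_rat_bits rat_bound_mono by blast+
  qed
  obtain D where D: "0 < D" "D \<le> 2 ^ (\<Sum>e \<leftarrow> es. ?bits e)"
    "\<And>u v a b. (u, v, a, b) \<in> set es \<Longrightarrow> of_int D * a \<in> \<int>"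
    "\<And>u v a b. (u, v, a, b) \<in> set es \<Longrightarrow> of_int D * b \<in> \<int>"
    using common_denominator[of es] by metis
  have "(2 :: int) ^ (\<Sum>e \<leftarrow> es. ?bits e) \<le> 2 ^ ?S"
    using sum_le by (rule power_increasing) simp
  then have D_le: "D \<le> 2 ^ ?S"
    using D(2) by (rule order_trans[rotated])
  have D_mult: "of_int D * ?w1 i \<in> \<int>" "of_int D * ?w2 i \<in> \<int>" if "i < length es" for i
    using D(3,4)[of "fst (es ! i)" "fst (snd (es ! i))" "?w1 i" "?w2 i"] nth_mem[OF that] by simp_all
  note facts = fin G nonneg bits n_le len D(1) D_le D_mult
  show thesis
  proof (rule that)
    show "encoded_graph ?G (num_verts I) ?S D ?w1 ?w2 es"
      unfolding encoded_graph_def encoded_graph_axioms_def using facts by simp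
    show "encoded_graph ?G (num_verts I) ?S D ?w2 ?w1 (map (\<lambda>(u, v, a, b). (u, v, b, a)) es)"
      unfolding encoded_graph_def encoded_graph_axioms_def using facts
      by (simp add: case_prod_beta)
  qed
qed

text \<open>The implication inside the postcondition separates cost from exactness:
  \<open>degenerate_feasible\<close> enters where interval tests stand in for
  \<open>covers\<close>.\<close>

lemma runs_vmtr_program:
  assumes I: "vmtr_instance (instance_of I)"
  shows "runs (vmtr_program I)
    (\<lambda>ls. degenerate_feasible (instance_of I) \<longrightarrow>
      vmtr_algorithm (instance_of I) = Some (real_of_rat ` set ls))
    (program_time (input_size I))"
proof -
  define N where "N = instance_of I"
  define n es ds S where "n = num_verts I" and "es = arc_list I" and "ds = demand_list I"
    and "S = input_size I"
  define B where "B = 12 * S + 2"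
  define es' where "es' = map (\<lambda>(u, v, a, b). (u, v, b, a)) es"
  note N = I[folded N_def]
  let ?w1 = "\<lambda>i. fst (snd (snd (es ! i)))" and ?w2 = "\<lambda>i. snd (snd (snd (es ! i)))"
  obtain D where
    enc1: "encoded_graph (graph N) n S D ?w1 ?w2 es" and
    enc2: "encoded_graph (graph N) n S D ?w2 ?w1 es'"
    using encoded_graph_of_instance[OF I] unfolding N_def n_def S_def es_def es'_def by metis
  have res: "res1 N i = of_rat (?w1 i)" "res2 N i = of_rat (?w2 i)" for i
    by (simp_all add: N_def instance_of_def es_def case_prod_beta)
  let ?bits = "\<lambda>(s, t, b1, b2). 1 + rat_bits b1 + rat_bits b2"
  have sum_le: "(\<Sum>d \<leftarrow> ds. ?bits d) \<le> S"
    by (simp add: input_size_def ds_def S_def)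
  have "length ds \<le> (\<Sum>d \<leftarrow> ds. ?bits d)"
    by (induction ds) auto
  then have len_ds: "length ds \<le> S"
    using sum_le by simp
  have len_es: "length es \<le> S"
    using enc1 by (simp add: encoded_graph_def encoded_graph_axioms_def)
  have demands: "demands N = {..<length ds}"
    by (simp add: N_def instance_of_def ds_def)
  have larac: "runs (larac n es s t b2)
      (\<lambda>res. \<exists>\<mu>. res = Some \<mu> \<and> real_of_rat \<mu> = lam_min N k \<and> rat_bound B \<mu>) (larac_time S) \<and>
    runs (larac n es' s t b1)
      (\<lambda>res. \<exists>\<mu>. res = Some \<mu> \<and> 1 / real_of_rat \<mu> = lam_max N k \<and> rat_bound B \<mu>) (larac_time S)"
    if k: "k \<in> set [0..<length ds]" and d: "ds ! k = (s, t, b1, b2)" for k s t b1 b2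
  proof -
    have kN: "k \<in> demands N"
      using k by (simp add: demands)
    have st: "source N k = s" "dest N k = t" "bound1 N k = real_of_rat b1" "bound2 N k = real_of_rat b2"
      using d by (simp_all add: N_def instance_of_def ds_def)
    obtain p0 where p0: "p0 \<in> demand_paths N k" "cost (res1 N) p0 \<le> real_of_rat b1"
      "cost (res2 N) p0 \<le> real_of_rat b2"
      using N kN by (auto simp: vmtr_instance_def within_bounds_def st)
    have "?bits (ds ! k) \<le> (\<Sum>d \<leftarrow> ds. ?bits d)"
      using k by (intro member_le_sum_list) auto
    then have "rat_bits b1 \<le> S" "rat_bits b2 \<le> S"
      using sum_le by (auto simp: d)
    then have bits: "rat_bound S b1" "rat_bound S b2"
      using rat_bound_rat_bits rat_bound_mono by blast+
    note out = shortest_path_violates[OF N kN, unfolded st]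
    have "runs (larac n es s t b2)
      (\<lambda>r. \<exists>\<mu>. r = Some \<mu> \<and> real_of_rat \<mu> = lam_min N k \<and> rat_bound B \<mu>) (larac_time S)"
      using encoded_graph.runs_larac_opt_multiplier
        [OF enc1 refl res bits(2) p0(1,3) out(1)]
      by (simp add: lam_min_def st B_def)
    \<comment> \<open>On the exchanged weights LARAC solves the dual that constrains resource 1,
      whose reciprocal multiplier is \<open>lam_max\<close>.\<close>
    moreover have "runs (larac n es' s t b1)
      (\<lambda>r. \<exists>\<mu>. r = Some \<mu> \<and> 1 / real_of_rat \<mu> = lam_max N k \<and> rat_bound B \<mu>) (larac_time S)"
      by (rule runs_mono[OF encoded_graph.runs_larac_opt_multiplier
          [OF enc2 refl res(2,1) bits(1) p0(1,2) out(2), unfolded st]])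
        (auto simp: lam_max_def st B_def)
    ultimately show ?thesis ..
  qed
  have pre: "runs (preprocess n es es' ds)
    (\<lambda>js. real_interval ` set js = (\<lambda>k. (lam_min N k, lam_max N k)) ` remaining N \<and>
      length js \<le> S \<and> (\<forall>j \<in> set js. rat_bound B (fst j) \<and> rat_bound B (snd j)))
    (S * (2 * larac_time S + 2 * op_time B + 1) + 1)"
  proof -
    have rem: "{k \<in> set [0..<length ds]. lam_min N k \<le> lam_max N k} = remaining N"
      by (auto simp: remaining_def demands)
    have "runs (preprocess n es es' (map ((!) ds) [0..<length ds]))
      (\<lambda>js. real_interval ` set js = (\<lambda>k. (lam_min N k, lam_max N k)) `
          {k \<in> set [0..<length ds]. lam_min N k \<le> lam_max N k} \<and>
        length js \<le> length [0..<length ds] \<and>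
        (\<forall>j \<in> set js. rat_bound B (fst j) \<and> rat_bound B (snd j)))
      (length [0..<length ds] * (2 * larac_time S + 2 * op_time B + 1) + 1)"
      by (rule runs_preprocess, simp add: B_def, rule larac)
    then show ?thesis
      unfolding map_nth rem
      by (rule runs_mono) (use len_ds in \<open>auto intro!: add_mono mult_right_mono\<close>)
  qed
  have lists: "runs (sort_demands ks \<bind> greedy_loop)
    (\<lambda>ls. degenerate_feasible N \<longrightarrow> vmtr_algorithm N = Some (real_of_rat ` set ls))
    ((S * (S * (op_time B + 1)) + 1) + (S * (S * (2 * op_time B + 1) + 2) + 1))"
    if ks: "real_interval ` set ks = (\<lambda>k. (lam_min N k, lam_max N k)) ` remaining N"
      "length ks \<le> S" "\<forall>j \<in> set ks. rat_bound B (fst j) \<and> rat_bound B (snd j)" for ks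
  proof (rule runs_bind[OF _ _ order_refl])
    show "runs (sort_demands ks) (\<lambda>js. js = sort_key snd ks) (S * (S * (op_time B + 1)) + 1)"
      by (rule runs_mono[OF runs_sort_demands[of ks B]])
        (use ks in \<open>auto intro!: add_mono mult_mono\<close>)
    fix js assume js: "js = sort_key snd ks"
    show "runs (greedy_loop js)
      (\<lambda>ls. degenerate_feasible N \<longrightarrow> vmtr_algorithm N = Some (real_of_rat ` set ls))
      (S * (S * (2 * op_time B + 1) + 2) + 1)"
    proof (rule runs_mono[OF runs_greedy_loop[of js B]])
      show "\<forall>j \<in> set js. rat_bound B (fst j) \<and> rat_bound B (snd j)"
        using ks by (simp add: js)
      show "degenerate_feasible N \<longrightarrow> vmtr_algorithm N = Some (real_of_rat ` set ls)"
        if "ls = greedy js" for ls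
        using vmtr_algorithm_eq_greedy[OF N, of js] ks(1) by (simp add: that js)
      show "length js * (length js * (2 * op_time B + 1) + 2) + 1
        \<le> S * (S * (2 * op_time B + 1) + 2) + 1"
        using ks(2) by (intro add_mono mult_mono order_refl) (auto simp: js)
    qed
  qed
  have swap: "runs (swap_resources es) (\<lambda>r. r = es') (S + 1)"
    by (rule runs_mono[OF runs_swap_resources]) (use len_es in \<open>auto simp: es'_def\<close>)
  show ?thesis
    unfolding vmtr_program_def N_def[symmetric] n_def[symmetric] es_def[symmetric]
      ds_def[symmetric] S_def[symmetric]
  proof (rule runs_bind[OF swap])
    fix r assume r: "r = es'"
    show "runs (do { ks \<leftarrow> preprocess n es r ds; js \<leftarrow> sort_demands ks; greedy_loop js })
      (\<lambda>ls. degenerate_feasible N \<longrightarrow> vmtr_algorithm N = Some (real_of_rat ` set ls))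
      ((S * (2 * larac_time S + 2 * op_time B + 1) + 1)
        + ((S * (S * (op_time B + 1)) + 1) + (S * (S * (2 * op_time B + 1) + 2) + 1)))"
      unfolding r
    proof (rule runs_bind[OF pre _ order_refl])
      show "runs (sort_demands ks \<bind> greedy_loop)
        (\<lambda>ls. degenerate_feasible N \<longrightarrow> vmtr_algorithm N = Some (real_of_rat ` set ls))
        ((S * (S * (op_time B + 1)) + 1) + (S * (S * (2 * op_time B + 1) + 2) + 1))"
        if "real_interval ` set ks = (\<lambda>k. (lam_min N k, lam_max N k)) ` remaining N \<and>
          length ks \<le> S \<and> (\<forall>j \<in> set ks. rat_bound B (fst j) \<and> rat_bound B (snd j))" for ks
        using that by (intro lists) blast+
    qed
  qed (simp add: program_time_def B_def)
qed

text \<open>Exactness concerns the abstract loop on arbitrary real data. It carries over to the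
  program on rational encodings because both return the same set of multipliers.\<close>

theorem mainTheorem2:
  shows "(\<forall>N :: ('v, 'a, 'k) vmtr. vmtr_instance N \<and> degenerate_feasible N \<longrightarrow>
            (\<exists>L. vmtr_algorithm N = Some L \<and>
                 optimal_design N L \<and>
                 (\<forall>k \<in> demands N - remaining N. \<forall>\<nu>\<ge>0. \<not> covers N \<nu> k) \<and>
                 (\<forall>k \<in> remaining N. \<exists>\<nu> \<in> L. covers N \<nu> k) \<and>
                 (\<forall>M. finite M \<and> M \<subseteq> {0..} \<and> (\<forall>k \<in> remaining N. \<exists>\<nu> \<in> M. covers N \<nu> k)
                    \<longrightarrow> card L \<le> card M))) \<and>
         (\<exists>p :: nat poly. \<forall>I. vmtr_instance (instance_of I) \<longrightarrow>
            (\<exists>ls t. vmtr_program I = Some (ls, t) \<and>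
                    t \<le> poly p (input_size I) \<and>
                    (degenerate_feasible (instance_of I) \<longrightarrow>
                       vmtr_algorithm (instance_of I) = Some (real_of_rat ` set ls))))"
proof (intro conjI allI impI)
  fix N :: "('v, 'a, 'k) vmtr"
  assume N: "vmtr_instance N \<and> degenerate_feasible N"
  obtain L where L: "vmtr_algorithm N = Some L" "optimal_design N L"
    "\<And>k \<nu>. k \<in> demands N - remaining N \<Longrightarrow> 0 \<le> \<nu> \<Longrightarrow> \<not> covers N \<nu> k"
    "\<And>k. k \<in> remaining N \<Longrightarrow> \<exists>\<nu> \<in> L. covers N \<nu> k"
    "\<And>M. finite M \<Longrightarrow> M \<subseteq> {0..} \<Longrightarrow> (\<And>k. k \<in> remaining N \<Longrightarrow> \<exists>\<nu> \<in> M. covers N \<nu> k)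
      \<Longrightarrow> card L \<le> card M"
    using vmtr_algorithm_exact[of N] N by blast
  show "\<exists>L. vmtr_algorithm N = Some L \<and>
      optimal_design N L \<and>
      (\<forall>k \<in> demands N - remaining N. \<forall>\<nu>\<ge>0. \<not> covers N \<nu> k) \<and>
      (\<forall>k \<in> remaining N. \<exists>\<nu> \<in> L. covers N \<nu> k) \<and>
      (\<forall>M. finite M \<and> M \<subseteq> {0..} \<and> (\<forall>k \<in> remaining N. \<exists>\<nu> \<in> M. covers N \<nu> k)
         \<longrightarrow> card L \<le> card M)"
  proof (intro exI[of _ L] conjI ballI allI impI)
    show "card L \<le> card M"
      if "finite M \<and> M \<subseteq> {0..} \<and> (\<forall>k \<in> remaining N. \<exists>\<nu> \<in> M. covers N \<nu> k)" for M
      using that by (intro L(5)) blast+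
  qed (use L in blast)+
next
  obtain p where "\<And>S. program_time S = poly p S"
    using polynomial_program_time by (auto simp: polynomial_def)
  then show "\<exists>p :: nat poly. \<forall>I. vmtr_instance (instance_of I) \<longrightarrow>
      (\<exists>ls t. vmtr_program I = Some (ls, t) \<and>
              t \<le> poly p (input_size I) \<and>
              (degenerate_feasible (instance_of I) \<longrightarrow>
                 vmtr_algorithm (instance_of I) = Some (real_of_rat ` set ls)))"
    using runs_vmtr_program unfolding runs_def by (intro exI[of _ p]) metis
qed

end
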